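(* Let $G$ be a finite nilpotent group of order $n$, and let $C_n$ denote the cyclic group of order $n$. Then $S_c(G)\leq S_c(C_n)$, with equality if and only if $G$ is cyclic.
   Context: All groups are finite. $\mathrm{Irr}(G)$ denotes the set of complex irreducible characters of a finite group $G$. For $\chi\in\mathrm{Irr}(G)$, the codegree of $\chi$ is $\mathrm{cod}(\chi)=\frac{|G:\ker\chi|}{\chi(1)}$. The sum of codegrees is $S_c(G)=\sum_{\chi\in\mathrm{Irr}(G)}\mathrm{cod}(\chi)$. *)

theory Defs
  imports "HOL-Algebra.Algebra" "Jordan_Normal_Form.VS_Connect"
begin

fun lower_central_series :: "('a, 'b) monoid_scheme \<Rightarrow> nat \<Rightarrow> 'a set" where
  "lower_central_series G 0 = carrier G"
| "lower_central_series G (Suc k) = generate G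
     (\<Union>x \<in> lower_central_series G k. \<Union>y \<in> carrier G.
        {x \<otimes>\<^bsub>G\<^esub> y \<otimes>\<^bsub>G\<^esub> inv\<^bsub>G\<^esub> x \<otimes>\<^bsub>G\<^esub> inv\<^bsub>G\<^esub> y})"

definition nilpotent_group :: "('a, 'b) monoid_scheme \<Rightarrow> bool" where
  "nilpotent_group G \<longleftrightarrow> (\<exists>k. lower_central_series G k = {\<one>\<^bsub>G\<^esub>})"

definition GL :: "nat \<Rightarrow> complex mat monoid" where
  "GL n = units_of (ring_mat TYPE(complex) n ())"

definition matrix_rep :: "('a, 'b) monoid_scheme \<Rightarrow> nat \<Rightarrow> ('a \<Rightarrow> complex mat) \<Rightarrow> bool" where
  "matrix_rep G n \<rho> \<longleftrightarrow> \<rho> \<in> hom G (GL n)"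

definition irreducible_rep :: "('a, 'b) monoid_scheme \<Rightarrow> nat \<Rightarrow> ('a \<Rightarrow> complex mat) \<Rightarrow> bool" where
  "irreducible_rep G n \<rho> \<longleftrightarrow> matrix_rep G n \<rho> \<and> 0 < n \<and>
     (\<forall>W. VectorSpace.subspace class_ring W (module_vec TYPE(complex) n) \<longrightarrow>
          (\<forall>g \<in> carrier G. \<forall>w \<in> W. \<rho> g *\<^sub>v w \<in> W) \<longrightarrow>
          W = {0\<^sub>v n} \<or> W = carrier_vec n)"

definition mat_trace :: "complex mat \<Rightarrow> complex" where
  "mat_trace A = (\<Sum>i < dim_row A. A $$ (i, i))"

(* Restricted to the carrier (undefined outside it), so that a character is determined by its
   values on the group and distinct elements of Irr G are distinct class functions. *)
definition rep_character :: "('a, 'b) monoid_scheme \<Rightarrow> ('a \<Rightarrow> complex mat) \<Rightarrow> 'a \<Rightarrow> complex" where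
  "rep_character G \<rho> = (\<lambda>g \<in> carrier G. mat_trace (\<rho> g))"

definition Irr :: "('a, 'b) monoid_scheme \<Rightarrow> ('a \<Rightarrow> complex) set" where
  "Irr G = {rep_character G \<rho> | n \<rho>. irreducible_rep G n \<rho>}"

definition char_kernel :: "('a, 'b) monoid_scheme \<Rightarrow> ('a \<Rightarrow> complex) \<Rightarrow> 'a set" where
  "char_kernel G \<chi> = {g \<in> carrier G. \<chi> g = \<chi> \<one>\<^bsub>G\<^esub>}"

(* The degree \<chi>(1) of a character is a positive integer, so taking its real part loses nothing. *)
definition codegree :: "('a, 'b) monoid_scheme \<Rightarrow> ('a \<Rightarrow> complex) \<Rightarrow> real" where
  "codegree G \<chi> = real (card (rcosets\<^bsub>G\<^esub> (char_kernel G \<chi>))) / Re (\<chi> \<one>\<^bsub>G\<^esub>)"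

(* For finite G the index set Irr G is finite, so the sum has its intended value. *)
definition codegree_sum :: "('a, 'b) monoid_scheme \<Rightarrow> real" where
  "codegree_sum G = (\<Sum>\<chi> \<in> Irr G. codegree G \<chi>)"

end

theory Submission
  imports Defs "Jordan_Normal_Form.Spectral_Radius" "Jordan_Normal_Form.Matrix_Kernel" "HOL-Number_Theory.Totient"
begin

text \<open>
  For the cyclic group of order \<open>n\<close> the irreducible characters are the \<open>n\<close> linear ones, and the codegree of a linear
  character is its order. So the codegree sum is \<open>F(n) = \<Sum> d \<phi>(d)\<close> over the divisors \<open>d\<close> of \<open>n\<close>.

  Now let \<open>G\<close> be nilpotent of order \<open>n\<close>. Choose \<open>z\<close> of order \<open>m\<close>, where \<open>m\<close> is coprime to \<open>h = n / m\<close> and as large as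
  possible. Elements of coprime order commute in a nilpotent group (\<open>coprime_ord_commute\<close>), so the centralizer of
  \<open>z\<close> contains a Sylow subgroup for every prime and \<open>z\<close> is central. By the choice of \<open>m\<close>, no Sylow subgroup for a
  prime dividing \<open>h\<close> is cyclic.

  Let \<open>\<chi>\<close> be the character of an irreducible representation of degree \<open>d\<close> with kernel \<open>K\<close>. By Schur's lemma \<open>z\<close> acts
  by a scalar, some root of unity of order \<open>m / g\<close>, and then \<open>g\<close> divides \<open>|K|\<close>. Moreover every prime \<open>p\<close> dividing
  \<open>h\<close> divides \<open>|K| d\<close> (\<open>prime_dvd_card_kernel_or_degree\<close>). Indeed, suppose that \<open>p\<close> does not divide \<open>d\<close>. A commutator
  of elements of a Sylow \<open>p\<close>-subgroup \<open>P\<close> that is central modulo \<open>K\<close> acts by a scalar \<open>c\<close> of \<open>p\<close>-power order, and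
  taking determinants gives \<open>c\<^sup>d = 1\<close>, so \<open>c = 1\<close>. Therefore \<open>P\<close> acts commutatively, hence by scalars, and as
  \<open>P\<close> is not cyclic it cannot act faithfully. Altogether \<open>g rad(h)\<close> divides \<open>|K| d\<close>, which bounds the codegree
  \<open>n / (|K| d)\<close> by \<open>(m / g) (h / rad h)\<close>.

  Irreducible characters are linearly independent, so at most \<open>h\<close> of them belong to the same scalar
  (\<open>card_Irr_over_scalar\<close>). Summing over the \<open>m\<close> possible scalars shows that the codegree sum of \<open>G\<close> is at most
  \<open>F(m) h\<^sup>2 / rad h\<close> (\<open>Irr_finite_codegree_sum_le\<close>). From \<open>h \<le> \<phi>(h) rad h\<close> this is at most \<open>F(m) h \<phi>(h)\<close>, which is the
  part of the sum \<open>F(n)\<close> that belongs to the multiples of \<open>h\<close>. If \<open>G\<close> is not cyclic, then \<open>h > 1\<close> and the divisor \<open>1\<close>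
  is missing from that part, so the inequality is strict.
\<close>

section \<open>Matrix representations and Schur's lemma\<close>

lemma matrix_repD:
  assumes "matrix_rep G n \<rho>"
  shows matrix_rep_carrier: "g \<in> carrier G \<Longrightarrow> \<rho> g \<in> carrier_mat n n"
    and matrix_rep_mult: "g \<in> carrier G \<Longrightarrow> h \<in> carrier G \<Longrightarrow> \<rho> (g \<otimes>\<^bsub>G\<^esub> h) = \<rho> g * \<rho> h"
  using assms
  by (auto simp: matrix_rep_def GL_def hom_def units_of_def Units_def ring_mat_def)

lemma matrix_rep_one:
  assumes "group G" "matrix_rep G n \<rho>"
  shows "\<rho> \<one>\<^bsub>G\<^esub> = 1\<^sub>m n"
proof -
  interpret R: ring "ring_mat TYPE(complex) n ()" by (rule ring_mat)
  have "group (GL n)" unfolding GL_def by (rule R.units_group)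
  then have "\<rho> \<one>\<^bsub>G\<^esub> = \<one>\<^bsub>GL n\<^esub>"
    using assms by (auto simp: matrix_rep_def intro!: hom_one)
  then show ?thesis by (simp add: GL_def units_of_def ring_mat_def)
qed

lemma matrix_rep_inv:
  assumes "group G" "matrix_rep G n \<rho>" "g \<in> carrier G"
  shows "\<rho> g * \<rho> (inv\<^bsub>G\<^esub> g) = 1\<^sub>m n" "\<rho> (inv\<^bsub>G\<^esub> g) * \<rho> g = 1\<^sub>m n"
proof -
  interpret group G by fact
  show "\<rho> g * \<rho> (inv\<^bsub>G\<^esub> g) = 1\<^sub>m n" "\<rho> (inv\<^bsub>G\<^esub> g) * \<rho> g = 1\<^sub>m n"
    using matrix_rep_mult[OF assms(2), symmetric] assms(3) matrix_rep_one[OF assms(1,2)]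
    by simp_all
qed

text \<open>
  A map into square matrices that is multiplicative and sends the identity to the identity
  takes invertible values automatically, because \<open>\<rho> (inv g)\<close> inverts \<open>\<rho> g\<close>.
\<close>

lemma matrix_repI:
  assumes "group G"
    and "\<And>g. g \<in> carrier G \<Longrightarrow> \<rho> g \<in> carrier_mat n n"
    and "\<And>g h. g \<in> carrier G \<Longrightarrow> h \<in> carrier G \<Longrightarrow> \<rho> (g \<otimes>\<^bsub>G\<^esub> h) = \<rho> g * \<rho> h"
    and "\<rho> \<one>\<^bsub>G\<^esub> = 1\<^sub>m n"
  shows "matrix_rep G n \<rho>"
proof -
  interpret group G by fact
  have "\<exists>B\<in>carrier_mat n n. B * \<rho> g = 1\<^sub>m n \<and> \<rho> g * B = 1\<^sub>m n" if "g \<in> carrier G" for g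
    using that assms(3)[of g "inv\<^bsub>G\<^esub> g"] assms(3)[of "inv\<^bsub>G\<^esub> g" g] assms(4)
    by (intro bexI[of _ "\<rho> (inv\<^bsub>G\<^esub> g)"] assms(2)) auto
  then show ?thesis
    using assms by (auto simp: matrix_rep_def GL_def hom_def units_of_def Units_def ring_mat_def)
qed

lemma irreducible_rep_matrix_rep: "irreducible_rep G n \<rho> \<Longrightarrow> matrix_rep G n \<rho>"
  and irreducible_rep_degree_pos: "irreducible_rep G n \<rho> \<Longrightarrow> 0 < n"
  by (simp_all add: irreducible_rep_def)

lemma subspace_mat_kernel:
  fixes A :: "complex mat"
  assumes A: "A \<in> carrier_mat r n"
  shows "VectorSpace.subspace class_ring (mat_kernel A) (module_vec TYPE(complex) n)"
proof -
  interpret V: vec_space "TYPE(complex)" n .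
  show ?thesis
    unfolding VectorSpace.subspace_def
    by (intro conjI V.vectorspace_axioms submodule.intro)
       (insert A mult_add_distrib_mat_vec[OF A] mult_mat_vec[OF A] mat_kernel[OF A],
        auto simp: class_ring_simps V.module_axioms)
qed

lemma mat_eq_zeroI:
  fixes A :: "complex mat"
  assumes A: "A \<in> carrier_mat m n" and v: "\<And>v. v \<in> carrier_vec n \<Longrightarrow> A *\<^sub>v v = 0\<^sub>v m"
  shows "A = 0\<^sub>m m n"
proof (rule eq_matI)
  fix i j assume "i < dim_row (0\<^sub>m m n :: complex mat)" "j < dim_col (0\<^sub>m m n :: complex mat)"
  then have ij: "i < m" "j < n" by simp_all
  have "A $$ (i, j) = (A *\<^sub>v unit_vec n j) $ i" using A ij by simp
  also have "\<dots> = 0" using v[of "unit_vec n j"] ij by simp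
  finally show "A $$ (i, j) = 0\<^sub>m m n $$ (i, j)" using ij by simp
qed (use A in simp_all)

text \<open>
  The only invariant subspaces to which irreducibility is applied below are kernels of matrices:
  a matrix with an invariant kernel is zero as soon as it kills one nonzero vector.
\<close>

lemma irreducible_rep_invariant_kernel:
  fixes T :: "complex mat"
  assumes irr: "irreducible_rep G n \<rho>" and T: "T \<in> carrier_mat r n"
    and inv: "\<And>g v. g \<in> carrier G \<Longrightarrow> v \<in> carrier_vec n \<Longrightarrow> T *\<^sub>v v = 0\<^sub>v r
      \<Longrightarrow> T *\<^sub>v (\<rho> g *\<^sub>v v) = 0\<^sub>v r"
    and v: "v \<in> carrier_vec n" "v \<noteq> 0\<^sub>v n" "T *\<^sub>v v = 0\<^sub>v r"
  shows "T = 0\<^sub>m r n"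
proof -
  have ker: "w \<in> mat_kernel T \<longleftrightarrow> w \<in> carrier_vec n \<and> T *\<^sub>v w = 0\<^sub>v r" for w
    by (simp add: mat_kernel[OF T])
  have "\<rho> g *\<^sub>v w \<in> mat_kernel T" if "g \<in> carrier G" "w \<in> mat_kernel T" for g w
    using that inv mult_mat_vec_carrier[OF matrix_rep_carrier[OF irreducible_rep_matrix_rep[OF irr]]]
    unfolding ker by blast
  then have "mat_kernel T = {0\<^sub>v n} \<or> mat_kernel T = carrier_vec n"
    using irr subspace_mat_kernel[OF T] unfolding irreducible_rep_def by blast
  moreover have "v \<in> mat_kernel T" using v unfolding ker by blast
  ultimately have full: "mat_kernel T = carrier_vec n" using v(2) by blast
  show ?thesis
  proof (rule mat_eq_zeroI[OF T])
    fix w :: "complex vec" assume "w \<in> carrier_vec n"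
    then show "T *\<^sub>v w = 0\<^sub>v r" using full ker by blast
  qed
qed

text \<open>
  Schur's lemma. Over the complex numbers \<open>A\<close> has an eigenvalue \<open>c\<close>; the kernel of
  \<open>A - c\<close> is invariant and nonzero, hence everything.
\<close>

lemma schur_scalar:
  fixes A :: "complex mat"
  assumes irr: "irreducible_rep G n \<rho>" and A: "A \<in> carrier_mat n n"
    and comm: "\<And>g. g \<in> carrier G \<Longrightarrow> A * \<rho> g = \<rho> g * A"
  shows "\<exists>c. A = c \<cdot>\<^sub>m 1\<^sub>m n"
proof -
  have "spectrum A \<noteq> {}" by (rule spectrum_non_empty[OF A irreducible_rep_degree_pos[OF irr]])
  then obtain c v where v: "v \<in> carrier_vec n" "v \<noteq> 0\<^sub>v n" "A *\<^sub>v v = c \<cdot>\<^sub>v v"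
    using A by (auto simp: spectrum_def eigenvalue_def eigenvector_def)
  define T where "T = A - c \<cdot>\<^sub>m 1\<^sub>m n"
  have T: "T \<in> carrier_mat n n" using A by (auto simp: T_def)
  have Tv: "T *\<^sub>v w = A *\<^sub>v w - c \<cdot>\<^sub>v w" if "w \<in> carrier_vec n" for w
    using that A by (simp add: T_def minus_mult_distrib_mat_vec[of _ n n])
       (auto intro!: arg_cong[of _ _ "\<lambda>x. _ - x"])
  have "T = 0\<^sub>m n n"
  proof (rule irreducible_rep_invariant_kernel[OF irr T])
    fix g w assume g: "g \<in> carrier G" and w: "w \<in> carrier_vec n" and Tw: "T *\<^sub>v w = 0\<^sub>v n"
    have R: "\<rho> g \<in> carrier_mat n n"
      by (rule matrix_rep_carrier[OF irreducible_rep_matrix_rep[OF irr] g])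
    have "A *\<^sub>v w - c \<cdot>\<^sub>v w = 0\<^sub>v n" using Tw Tv[OF w] by simp
    then have "A *\<^sub>v w = c \<cdot>\<^sub>v w"
      using A w by (intro eq_vecI) (auto simp: vec_eq_iff)
    then have "\<rho> g *\<^sub>v (A *\<^sub>v w) = c \<cdot>\<^sub>v (\<rho> g *\<^sub>v w)"
      using mult_mat_vec[OF R w] by simp
    moreover have "\<rho> g *\<^sub>v (A *\<^sub>v w) = A *\<^sub>v (\<rho> g *\<^sub>v w)"
      using assoc_mult_mat_vec[OF A R w] assoc_mult_mat_vec[OF R A w] comm[OF g] by simp
    ultimately show "T *\<^sub>v (\<rho> g *\<^sub>v w) = 0\<^sub>v n" using Tv[of "\<rho> g *\<^sub>v w"] R w by simp
  qed (use v Tv in auto)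
  then have "A = c \<cdot>\<^sub>m 1\<^sub>m n"
    using A unfolding T_def by (intro eq_matI) (auto simp: mat_eq_iff)
  then show ?thesis by blast
qed

section \<open>Orthogonality of irreducible characters\<close>

lemma mat_trace_mult:
  assumes A: "A \<in> carrier_mat n m" and B: "B \<in> carrier_mat m n"
  shows "mat_trace (A * B) = (\<Sum>i<n. \<Sum>j<m. A $$ (i, j) * B $$ (j, i))"
  unfolding mat_trace_def
proof (rule sum.cong)
  fix i assume "i \<in> {..<n}"
  then show "(A * B) $$ (i, i) = (\<Sum>j<m. A $$ (i, j) * B $$ (j, i))"
    using A B by (subst index_mult_mat) (auto simp: scalar_prod_def atLeast0LessThan)
qed (use A in simp)

lemma mat_trace_mult_comm:
  assumes A: "A \<in> carrier_mat n m" and B: "B \<in> carrier_mat m n"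
  shows "mat_trace (A * B) = mat_trace (B * A)"
  unfolding mat_trace_mult[OF A B] mat_trace_mult[OF B A]
  by (subst sum.swap) (simp only: mult.commute)

text \<open>
  Up to the factor \<open>1/|G|\<close> this is the usual inner product of class functions, with \<open>\<psi> (inv g)\<close>
  in place of the complex conjugate of \<open>\<psi> g\<close>. Being bilinear, it can be computed from matrix entries.
\<close>

definition char_pairing :: "('a, 'b) monoid_scheme \<Rightarrow> ('a \<Rightarrow> complex) \<Rightarrow> ('a \<Rightarrow> complex) \<Rightarrow> complex" where
  "char_pairing G \<phi> \<psi> = (\<Sum>g\<in>carrier G. \<phi> g * \<psi> (inv\<^bsub>G\<^esub> g))"

lemma char_pairing_commute:
  assumes "group G"
  shows "char_pairing G \<phi> \<psi> = char_pairing G \<psi> \<phi>"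
proof -
  interpret group G by fact
  show ?thesis
    unfolding char_pairing_def
    by (rule sum.reindex_bij_witness[of _ "\<lambda>g. inv\<^bsub>G\<^esub> g" "\<lambda>g. inv\<^bsub>G\<^esub> g"]) (simp_all add: mult.commute)
qed

text \<open>
  The sum \<open>\<Sum>\<^sub>g \<rho>(g) E\<^sub>a\<^sub>b \<sigma>(g\<inverse>)\<close> over the group, for the matrix unit \<open>E\<^sub>a\<^sub>b\<close>, written out entrywise.
  It intertwines the two representations, and the pairing of their characters is the sum of
  the \<open>(a,b)\<close> entries of these matrices.
\<close>

definition averaged_unit ::
  "('a, 'b) monoid_scheme \<Rightarrow> nat \<Rightarrow> ('a \<Rightarrow> complex mat) \<Rightarrow> nat \<Rightarrow> ('a \<Rightarrow> complex mat) \<Rightarrow> nat \<Rightarrow> nat \<Rightarrow> complex mat"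
  where "averaged_unit G m \<rho> n \<sigma> a b =
    mat m n (\<lambda>(c, d). \<Sum>g\<in>carrier G. \<rho> g $$ (c, a) * \<sigma> (inv\<^bsub>G\<^esub> g) $$ (b, d))"

lemma averaged_unit_carrier [simp]: "averaged_unit G m \<rho> n \<sigma> a b \<in> carrier_mat m n"
  by (simp add: averaged_unit_def)

text \<open>
  Multiplying by \<open>\<rho> h\<close> from the left shifts the summation variable from \<open>g\<close> to \<open>h g\<close>.
\<close>

lemma averaged_unit_intertwines:
  fixes G (structure)
  assumes G: "group G" and \<rho>: "matrix_rep G m \<rho>" and \<sigma>: "matrix_rep G n \<sigma>"
    and ab: "a < m" "b < n" and h: "h \<in> carrier G"
  shows "\<rho> h * averaged_unit G m \<rho> n \<sigma> a b = averaged_unit G m \<rho> n \<sigma> a b * \<sigma> h"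
proof -
  interpret group G by fact
  note [simp] = matrix_rep_carrier[OF \<rho>] matrix_rep_carrier[OF \<sigma>]
  have dims [simp]: "dim_row (\<rho> g) = m" "dim_col (\<rho> g) = m" "dim_row (\<sigma> g) = n" "dim_col (\<sigma> g) = n"
    if "g \<in> carrier G" for g
    using matrix_rep_carrier[OF \<rho> that] matrix_rep_carrier[OF \<sigma> that] by auto
  let ?T = "averaged_unit G m \<rho> n \<sigma> a b"
  show ?thesis
  proof (rule eq_matI)
    fix c d assume "c < dim_row (?T * \<sigma> h)" "d < dim_col (?T * \<sigma> h)"
    then have cd: "c < m" "d < n" using h by (auto simp: averaged_unit_def)
    have "(\<rho> h * ?T) $$ (c, d) =
        (\<Sum>k<m. \<Sum>g\<in>carrier G. \<rho> h $$ (c, k) * (\<rho> g $$ (k, a) * \<sigma> (inv g) $$ (b, d)))"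
      using cd h by (simp add: averaged_unit_def scalar_prod_def atLeast0LessThan sum_distrib_left)
    also have "\<dots> = (\<Sum>g\<in>carrier G. (\<rho> h * \<rho> g) $$ (c, a) * \<sigma> (inv g) $$ (b, d))"
      using cd h ab
      by (subst sum.swap) (auto simp: scalar_prod_def atLeast0LessThan sum_distrib_right mult.assoc intro!: sum.cong)
    also have "\<dots> = (\<Sum>g\<in>carrier G. \<rho> (h \<otimes> g) $$ (c, a) * \<sigma> (inv g) $$ (b, d))"
      using h by (intro sum.cong) (auto simp: matrix_rep_mult[OF \<rho>])
    also have "\<dots> = (\<Sum>g\<in>carrier G. \<rho> g $$ (c, a) * \<sigma> (inv g \<otimes> h) $$ (b, d))"
      by (rule sum.reindex_bij_witness[of _ "\<lambda>g. inv h \<otimes> g" "\<lambda>g. h \<otimes> g"])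
         (use h in \<open>auto simp: m_assoc[symmetric] inv_mult_group\<close>, simp add: m_assoc)
    also have "\<dots> = (\<Sum>g\<in>carrier G. \<rho> g $$ (c, a) * (\<sigma> (inv g) * \<sigma> h) $$ (b, d))"
      using h by (intro sum.cong) (auto simp: matrix_rep_mult[OF \<sigma>])
    also have "\<dots> = (\<Sum>k<n. \<Sum>g\<in>carrier G. \<rho> g $$ (c, a) * \<sigma> (inv g) $$ (b, k) * \<sigma> h $$ (k, d))"
      using cd h ab
      by (subst sum.swap) (auto simp: scalar_prod_def atLeast0LessThan sum_distrib_left mult.assoc intro!: sum.cong)
    also have "\<dots> = (?T * \<sigma> h) $$ (c, d)"
      using cd h by (simp add: averaged_unit_def scalar_prod_def atLeast0LessThan sum_distrib_right)
    finally show "(\<rho> h * ?T) $$ (c, d) = (?T * \<sigma> h) $$ (c, d)" .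
  qed (use h in \<open>auto simp: averaged_unit_def\<close>)
qed

lemma char_pairing_averaged_unit:
  fixes G (structure)
  assumes G: "group G" and \<rho>: "matrix_rep G m \<rho>" and \<sigma>: "matrix_rep G n \<sigma>"
  shows "char_pairing G (rep_character G \<rho>) (rep_character G \<sigma>) =
    (\<Sum>c<m. \<Sum>d<n. averaged_unit G m \<rho> n \<sigma> c d $$ (c, d))"
proof -
  interpret group G by fact
  have dims [simp]: "dim_row (\<rho> g) = m" "dim_row (\<sigma> g) = n" if "g \<in> carrier G" for g
    using matrix_rep_carrier[OF \<rho> that] matrix_rep_carrier[OF \<sigma> that] by auto
  have "char_pairing G (rep_character G \<rho>) (rep_character G \<sigma>) =
      (\<Sum>g\<in>carrier G. \<Sum>c<m. \<Sum>d<n. \<rho> g $$ (c, c) * \<sigma> (inv g) $$ (d, d))"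
    by (auto simp: char_pairing_def rep_character_def mat_trace_def sum_product intro!: sum.cong)
  also have "\<dots> = (\<Sum>c<m. \<Sum>d<n. \<Sum>g\<in>carrier G. \<rho> g $$ (c, c) * \<sigma> (inv g) $$ (d, d))"
    by (subst sum.swap, intro sum.cong refl, subst sum.swap) simp
  also have "\<dots> = (\<Sum>c<m. \<Sum>d<n. averaged_unit G m \<rho> n \<sigma> c d $$ (c, d))"
    by (auto simp: averaged_unit_def intro!: sum.cong)
  finally show ?thesis .
qed

lemma irreducible_intertwiner_injective:
  assumes \<sigma>: "irreducible_rep G n \<sigma>" and \<rho>: "matrix_rep G m \<rho>"
    and T: "T \<in> carrier_mat m n" and int: "\<And>g. g \<in> carrier G \<Longrightarrow> \<rho> g * T = T * \<sigma> g"
    and nz: "T \<noteq> 0\<^sub>m m n" and v: "v \<in> carrier_vec n" "T *\<^sub>v v = 0\<^sub>v m"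
  shows "v = 0\<^sub>v n"
proof (rule ccontr)
  assume "v \<noteq> 0\<^sub>v n"
  have "T *\<^sub>v (\<sigma> g *\<^sub>v w) = 0\<^sub>v m"
    if "g \<in> carrier G" "w \<in> carrier_vec n" "T *\<^sub>v w = 0\<^sub>v m" for g w
  proof -
    have R: "\<rho> g \<in> carrier_mat m m" and Q: "\<sigma> g \<in> carrier_mat n n"
      using matrix_rep_carrier[OF \<rho> that(1)]
        matrix_rep_carrier[OF irreducible_rep_matrix_rep[OF \<sigma>] that(1)] by auto
    have "T *\<^sub>v (\<sigma> g *\<^sub>v w) = \<rho> g *\<^sub>v (T *\<^sub>v w)"
      using assoc_mult_mat_vec[OF T Q that(2)] assoc_mult_mat_vec[OF R T that(2)] int[OF that(1)]
      by simp
    moreover have "\<rho> g *\<^sub>v 0\<^sub>v m = 0\<^sub>v m" using R by (intro eq_vecI) simp_all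
    ultimately show ?thesis using that(3) by simp
  qed
  then show False
    using irreducible_rep_invariant_kernel[OF \<sigma> T _ v(1) \<open>v \<noteq> 0\<^sub>v n\<close> v(2)] nz by blast
qed

lemma smult_eq_imp_scalar_eq:
  assumes "c \<cdot>\<^sub>m T = d \<cdot>\<^sub>m T" "T \<in> carrier_mat m n" "T \<noteq> 0\<^sub>m m n"
  shows "c = (d::complex)"
proof -
  obtain i j where "i < m" "j < n" "T $$ (i, j) \<noteq> 0"
    using assms(2,3) by (metis carrier_matD eq_matI index_zero_mat)
  moreover from this have "(c \<cdot>\<^sub>m T) $$ (i, j) = (d \<cdot>\<^sub>m T) $$ (i, j)" using assms(1) by simp
  ultimately show ?thesis using assms(2) by simp
qed

text \<open>
  If \<open>T S\<close> and \<open>S T\<close> are the same nonzero scalar, then \<open>T\<close> conjugates \<open>\<sigma>\<close> into \<open>\<rho>\<close>. The two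
  traces agree because \<open>T\<close> can be moved cyclically through the trace.
\<close>

lemma rep_character_eq_of_intertwiners:
  assumes \<rho>: "matrix_rep G m \<rho>" and \<sigma>: "matrix_rep G n \<sigma>"
    and T: "T \<in> carrier_mat m n" "\<And>g. g \<in> carrier G \<Longrightarrow> \<rho> g * T = T * \<sigma> g"
    and S: "S \<in> carrier_mat n m"
    and TS: "T * S = c \<cdot>\<^sub>m 1\<^sub>m m" and ST: "S * T = c \<cdot>\<^sub>m 1\<^sub>m n" and c: "c \<noteq> 0"
  shows "rep_character G \<rho> = rep_character G \<sigma>"
proof -
  have "mat_trace (\<rho> g) = mat_trace (\<sigma> g)" if g: "g \<in> carrier G" for g
  proof -
    have R [simp]: "\<rho> g \<in> carrier_mat m m" and Q [simp]: "\<sigma> g \<in> carrier_mat n n"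
      using g matrix_rep_carrier[OF \<rho>] matrix_rep_carrier[OF \<sigma>] by auto
    have tr: "mat_trace (c \<cdot>\<^sub>m A) = c * mat_trace A" if "A \<in> carrier_mat k k" for A k
      using that by (simp add: mat_trace_def sum_distrib_left)
    have "c * mat_trace (\<rho> g) = mat_trace (\<rho> g * (T * S))"
      using tr[OF R] mult_smult_distrib[OF R one_carrier_mat] right_mult_one_mat[OF R] TS by simp
    also have "\<dots> = mat_trace ((T * \<sigma> g) * S)"
      using T S g by (simp add: assoc_mult_mat[of _ m m _ n _ m, symmetric])
    also have "\<dots> = mat_trace (T * (\<sigma> g * S))"
      using T S by (simp add: assoc_mult_mat[of _ m n _ n _ m])
    also have "\<dots> = mat_trace ((\<sigma> g * S) * T)"
      using T S Q by (intro mat_trace_mult_comm mult_carrier_mat)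
    also have "\<dots> = mat_trace (\<sigma> g * (S * T))"
      using T S by (simp add: assoc_mult_mat[of _ n n _ m _ n])
    also have "\<dots> = c * mat_trace (\<sigma> g)"
      using tr[OF Q] mult_smult_distrib[OF Q one_carrier_mat] right_mult_one_mat[OF Q] ST by simp
    finally show ?thesis using c by simp
  qed
  then show ?thesis by (auto simp: rep_character_def)
qed

text \<open>
  Let \<open>T\<close> be a nonzero averaged unit from \<open>\<sigma>\<close> to \<open>\<rho>\<close> and \<open>S\<close> any averaged unit in the other
  direction. By Schur's lemma \<open>T S\<close> is a scalar, and it is the same scalar as \<open>S T\<close>; a nonzero value would
  make the characters equal. So \<open>T S = 0\<close>, and as \<open>T\<close> is injective, \<open>S = 0\<close>. Hence all averaged units vanish in
  one of the two directions, which is enough because the pairing is symmetric.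
\<close>

lemma character_orthogonality:
  assumes G: "group G" and \<rho>: "irreducible_rep G m \<rho>" and \<sigma>: "irreducible_rep G n \<sigma>"
    and ne: "rep_character G \<rho> \<noteq> rep_character G \<sigma>"
  shows "char_pairing G (rep_character G \<rho>) (rep_character G \<sigma>) = 0"
proof (cases "\<forall>a<m. \<forall>b<n. averaged_unit G m \<rho> n \<sigma> a b = 0\<^sub>m m n")
  case True
  then show ?thesis
    by (simp add: char_pairing_averaged_unit[OF G \<rho>[THEN irreducible_rep_matrix_rep] \<sigma>[THEN irreducible_rep_matrix_rep]])
next
  case False
  note \<rho>' = \<rho>[THEN irreducible_rep_matrix_rep] and \<sigma>' = \<sigma>[THEN irreducible_rep_matrix_rep]
  obtain T where T: "T \<in> carrier_mat m n" "T \<noteq> 0\<^sub>m m n"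
    and Tint: "\<And>g. g \<in> carrier G \<Longrightarrow> \<rho> g * T = T * \<sigma> g"
    using False averaged_unit_intertwines[OF G \<rho>' \<sigma>'] averaged_unit_carrier by metis
  have "averaged_unit G n \<sigma> m \<rho> a b = 0\<^sub>m n m" if ab: "a < n" "b < m" for a b
  proof -
    define S where "S = averaged_unit G n \<sigma> m \<rho> a b"
    have S: "S \<in> carrier_mat n m" by (simp add: S_def)
    have Sint: "\<sigma> g * S = S * \<rho> g" if "g \<in> carrier G" for g
      using averaged_unit_intertwines[OF G \<sigma>' \<rho>' ab that] by (simp add: S_def)
    have "(T * S) * \<rho> g = \<rho> g * (T * S)" if g: "g \<in> carrier G" for g
      using Tint[OF g] Sint[OF g] T S matrix_rep_carrier[OF \<rho>' g] matrix_rep_carrier[OF \<sigma>' g]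
      by (smt (verit) assoc_mult_mat)
    then obtain c where c: "T * S = c \<cdot>\<^sub>m 1\<^sub>m m"
      using schur_scalar[OF \<rho>, of "T * S"] T S by auto
    have "(S * T) * \<sigma> g = \<sigma> g * (S * T)" if g: "g \<in> carrier G" for g
      using Tint[OF g] Sint[OF g] T S matrix_rep_carrier[OF \<rho>' g] matrix_rep_carrier[OF \<sigma>' g]
      by (smt (verit) assoc_mult_mat)
    then obtain d where d: "S * T = d \<cdot>\<^sub>m 1\<^sub>m n"
      using schur_scalar[OF \<sigma>, of "S * T"] T S by auto
    have "c \<cdot>\<^sub>m T = (T * S) * T" using T S by (simp add: c mult_smult_assoc_mat[of _ m m _ n])
    also have "\<dots> = T * (S * T)" using T S by simp
    also have "\<dots> = d \<cdot>\<^sub>m T" using T S by (simp add: d mult_smult_distrib[of _ m n _ n])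
    finally have "c = d" using smult_eq_imp_scalar_eq T by blast
    then have "c = 0"
      using rep_character_eq_of_intertwiners[OF \<rho>' \<sigma>' T(1) Tint S c] d ne by blast
    have "S = 0\<^sub>m n m"
    proof (rule mat_eq_zeroI[OF S])
      fix v :: "complex vec" assume v: "v \<in> carrier_vec m"
      have "T *\<^sub>v (S *\<^sub>v v) = (T * S) *\<^sub>v v" using T S v by simp
      also have "\<dots> = 0\<^sub>v m" using v by (auto simp: c \<open>c = 0\<close> intro!: eq_vecI)
      finally show "S *\<^sub>v v = 0\<^sub>v n"
        using irreducible_intertwiner_injective[OF \<sigma> \<rho>' T(1) Tint T(2)] S v by auto
    qed
    then show ?thesis by (simp add: S_def)
  qed
  then have "char_pairing G (rep_character G \<sigma>) (rep_character G \<rho>) = 0"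
    by (simp add: char_pairing_averaged_unit[OF G \<sigma>' \<rho>'])
  then show ?thesis using char_pairing_commute[OF G] by metis
qed

text \<open>
  For \<open>\<rho> = \<sigma>\<close> the averaged units are scalars by Schur's lemma, and their traces identify them as
  \<open>\<delta>\<^sub>a\<^sub>b |G| / n\<close>.
\<close>

lemma character_norm:
  fixes G (structure)
  assumes G: "group G" and \<rho>: "irreducible_rep G n \<rho>"
  shows "char_pairing G (rep_character G \<rho>) (rep_character G \<rho>) = of_nat (card (carrier G))"
proof -
  interpret group G by fact
  note \<rho>' = \<rho>[THEN irreducible_rep_matrix_rep]
  have n: "n > 0" by (rule irreducible_rep_degree_pos[OF \<rho>])
  have dims [simp]: "dim_row (\<rho> g) = n" "dim_col (\<rho> g) = n" if "g \<in> carrier G" for g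
    using matrix_rep_carrier[OF \<rho>' that] by auto
  have entry: "averaged_unit G n \<rho> n \<rho> a b $$ (a, b) =
      (if a = b then of_nat (card (carrier G)) / of_nat n else 0)" if ab: "a < n" "b < n" for a b
  proof -
    let ?T = "averaged_unit G n \<rho> n \<rho> a b"
    obtain c where c: "?T = c \<cdot>\<^sub>m 1\<^sub>m n"
      using schur_scalar[OF \<rho>, of ?T] averaged_unit_intertwines[OF G \<rho>' \<rho>' ab] by auto
    have "of_nat n * c = mat_trace ?T" by (simp add: c mat_trace_def)
    also have "\<dots> = (\<Sum>k<n. \<Sum>g\<in>carrier G. \<rho> (inv g) $$ (b, k) * \<rho> g $$ (k, a))"
      by (simp add: mat_trace_def averaged_unit_def mult.commute)
    also have "\<dots> = (\<Sum>g\<in>carrier G. (\<rho> (inv g) * \<rho> g) $$ (b, a))"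
      using ab by (subst sum.swap) (auto simp: scalar_prod_def atLeast0LessThan intro!: sum.cong)
    also have "\<dots> = (\<Sum>g\<in>carrier G. if a = b then 1 else 0)"
      using ab by (intro sum.cong) (auto simp: matrix_rep_inv[OF G \<rho>'])
    finally have "c = (if a = b then of_nat (card (carrier G)) / of_nat n else 0)"
      using n by (auto simp: field_simps)
    then show ?thesis using ab by (auto simp: c)
  qed
  have "char_pairing G (rep_character G \<rho>) (rep_character G \<rho>) =
      (\<Sum>c<n. \<Sum>d<n. if c = d then of_nat (card (carrier G)) / of_nat n else 0)"
    unfolding char_pairing_averaged_unit[OF G \<rho>' \<rho>'] by (intro sum.cong refl entry) auto
  also have "\<dots> = of_nat (card (carrier G))" using n by simp
  finally show ?thesis .
qed

section \<open>Counting the irreducible characters over a central scalar\<close>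

text \<open>
  Padded with zero equations, the system has a square matrix of determinant zero.
\<close>

lemma homogeneous_system_nontrivial:
  fixes A :: "'s \<Rightarrow> 'i \<Rightarrow> 'c :: field"
  assumes S: "finite S" and I: "finite I" and less: "card I < card S"
  shows "\<exists>v. (\<exists>s\<in>S. v s \<noteq> 0) \<and> (\<forall>i\<in>I. (\<Sum>s\<in>S. v s * A s i) = 0)"
proof -
  let ?N = "card S"
  obtain e where e: "bij_betw e {0..<?N} S" using ex_bij_betw_nat_finite[OF S] by blast
  obtain f where f: "bij_betw f {0..<card I} I" using ex_bij_betw_nat_finite[OF I] by blast
  define M where "M = mat ?N ?N (\<lambda>(i, j). if i < card I then A (e j) (f i) else 0)"
  have M: "M \<in> carrier_mat ?N ?N" by (simp add: M_def)
  \<comment> \<open>There is at least one padding row, the last one, of index \<open>l\<close>.\<close>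
  obtain l where l: "?N = Suc l" "card I \<le> l" using less less_imp_Suc_add[OF less] by (metis le_add1)
  let ?R = "mat\<^sub>r ?N ?N (\<lambda>i. if i = l then 0\<^sub>v ?N else row M i)"
  have "M = ?R"
  proof (rule eq_matI)
    fix i j assume "i < dim_row ?R" "j < dim_col ?R"
    then have ij: "i < ?N" "j < ?N" by simp_all
    show "M $$ (i, j) = ?R $$ (i, j)"
    proof (cases "i = l")
      case True
      then have "\<not> i < card I" using l(2) by simp
      then show ?thesis unfolding M_def index_mat(1)[OF ij] index_mat(2)[OF ij] using True ij by simp
    next
      case False
      then show ?thesis unfolding index_mat(2)[OF ij] using ij M by simp
    qed
  qed (use M in simp_all)
  moreover have "det ?R = 0" using l(1) M by (intro det_row_0) auto
  ultimately have "det M = 0" by metis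
  then obtain v where v: "v \<in> carrier_vec ?N" "v \<noteq> 0\<^sub>v ?N" "M *\<^sub>v v = 0\<^sub>v ?N"
    using det_0_iff_vec_prod_zero_field[OF M] by blast
  define w where "w s = v $ the_inv_into {0..<?N} e s" for s
  have we: "w (e j) = v $ j" if "j < ?N" for j
    using that the_inv_into_f_f[OF bij_betw_imp_inj_on[OF e], of j] by (simp add: w_def)
  have "\<exists>j<?N. v $ j \<noteq> 0"
  proof (rule ccontr)
    assume "\<not> ?thesis"
    then have "v = 0\<^sub>v ?N" using v(1) by (intro eq_vecI) auto
    then show False using v(2) by contradiction
  qed
  then obtain j where j: "j < ?N" "w (e j) \<noteq> 0" using we by auto
  moreover have "e j \<in> S" using bij_betwE[OF e] j(1) by simp
  ultimately have nz: "\<exists>s\<in>S. w s \<noteq> 0" by blast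
  have "(\<Sum>s\<in>S. w s * A s i) = 0" if "i \<in> I" for i
  proof -
    have "i \<in> f ` {0..<card I}" using that bij_betw_imp_surj_on[OF f] by blast
    then obtain k where k: "k < card I" "i = f k" by auto
    have "0 = (M *\<^sub>v v) $ k" using v(3) k(1) less by simp
    also have "\<dots> = row M k \<bullet> v" using k(1) less M by simp
    also have "\<dots> = (\<Sum>j\<in>{0..<?N}. M $$ (k, j) * v $ j)"
      using v(1) k(1) less M by (simp add: scalar_prod_def)
    also have "\<dots> = (\<Sum>j\<in>{0..<?N}. A (e j) i * v $ j)"
      using k less by (intro sum.cong) (simp_all add: M_def)
    also have "\<dots> = (\<Sum>j\<in>{0..<?N}. w (e j) * A (e j) i)"
      using we by (intro sum.cong) (simp_all add: mult.commute)
    also have "\<dots> = (\<Sum>s\<in>S. w s * A s i)" by (rule sum.reindex_bij_betw[OF e])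
    finally show ?thesis by simp
  qed
  with nz show ?thesis by blast
qed

lemma Irr_char_pairing:
  assumes "group G" "\<chi> \<in> Irr G" "\<psi> \<in> Irr G"
  shows "char_pairing G \<chi> \<psi> = (if \<chi> = \<psi> then of_nat (card (carrier G)) else 0)"
  using assms character_orthogonality[OF assms(1)] character_norm[OF assms(1)]
  unfolding Irr_def by auto

text \<open>
  Characters that \<open>z\<close> multiplies by the same scalar \<open>\<zeta>\<close> are determined by their values on representatives of
  the cosets of \<open>\<langle>z\<rangle>\<close>. They therefore live in a space of dimension at most the number of these cosets, and
  orthogonality makes distinct irreducible characters linearly independent.
\<close>

lemma card_Irr_over_scalar:
  fixes G (structure)
  assumes G: "group G" and fin: "finite (carrier G)" and z: "z \<in> carrier G"
    and C: "C \<subseteq> Irr G"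
    and scal: "\<And>\<chi> g. \<chi> \<in> C \<Longrightarrow> g \<in> carrier G \<Longrightarrow> \<chi> (z \<otimes> g) = \<zeta> * \<chi> g"
  shows "finite C \<and> card C \<le> Coset.order G div group.ord G z"
proof -
  interpret group G by fact
  let ?Z = "generate G {z}"
  have Z: "subgroup ?Z G" using z by (intro generate_is_subgroup) auto
  have cardZ: "card ?Z = ord z" using generate_pow_card[OF z] by simp
  have "card (rcosets ?Z) * ord z = Coset.order G" using lagrange[OF Z] cardZ by simp
  moreover have "ord z > 0" using ord_ge_1[OF fin z] by simp
  ultimately have index: "card (rcosets ?Z) = Coset.order G div ord z" by (metis div_mult_self_is_m)
  have finR: "finite (rcosets ?Z)" by (rule finite_UnionD) (simp add: fin rcosets_part_G[OF Z])
  define rep where "rep R = (SOME g. g \<in> carrier G \<and> R = ?Z #> g)" for R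
  have rep: "rep R \<in> carrier G \<and> R = ?Z #> rep R" if "R \<in> rcosets ?Z" for R
  proof -
    have "\<exists>g. g \<in> carrier G \<and> R = ?Z #> g" using that by (auto simp: RCOSETS_def)
    then show ?thesis unfolding rep_def by (rule someI_ex)
  qed
  show ?thesis unfolding index[symmetric]
  proof (rule finite_if_finite_subsets_card_bdd)
    fix S assume S: "S \<subseteq> C" "finite S"
    show "card S \<le> card (rcosets ?Z)"
    proof (rule ccontr)
      assume "\<not> ?thesis"
      then have "card (rcosets ?Z) < card S" by simp
      from homogeneous_system_nontrivial[OF S(2) finR this, of "\<lambda>\<chi> R. \<chi> (rep R)"]
      obtain v where v: "\<exists>\<chi>\<in>S. v \<chi> \<noteq> 0"
        "\<forall>R\<in>rcosets ?Z. (\<Sum>\<chi>\<in>S. v \<chi> * \<chi> (rep R)) = 0"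
        by blast
      have pow: "\<chi> (z [^] k \<otimes> g) = \<zeta> ^ k * \<chi> g" if "\<chi> \<in> S" "g \<in> carrier G" for \<chi> g and k :: nat
      proof (induction k)
        case (Suc k)
        have "z [^] Suc k \<otimes> g = z \<otimes> (z [^] k \<otimes> g)" using that z nat_pow_Suc2[OF z] by (simp add: m_assoc)
        moreover have "\<chi> (z \<otimes> (z [^] k \<otimes> g)) = \<zeta> * \<chi> (z [^] k \<otimes> g)"
          using that z S(1) by (intro scal) auto
        ultimately show ?case using Suc by simp
      qed (use that in simp)
      \<comment> \<open>The linear relation on coset representatives extends to all of the group,
        as moving by a power of \<open>z\<close> only multiplies it by a power of \<open>\<zeta>\<close>.\<close>
      have zero: "(\<Sum>\<chi>\<in>S. v \<chi> * \<chi> g) = 0" if g: "g \<in> carrier G" for g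
      proof -
        let ?R = "?Z #> g"
        have R: "?R \<in> rcosets ?Z" using g by (auto simp: RCOSETS_def)
        have repR: "rep ?R \<in> carrier G" using rep[OF R] by blast
        have "g \<in> ?Z #> rep ?R" using conjunct2[OF rep[OF R]] rcos_self[OF g Z] by blast
        then obtain y where "y \<in> ?Z" "g = y \<otimes> rep ?R" by (auto simp: r_coset_def)
        then obtain k :: nat where k: "g = z [^] k \<otimes> rep ?R"
          using generate_pow_on_finite_carrier[OF fin z] by auto
        have "(\<Sum>\<chi>\<in>S. v \<chi> * \<chi> g) = \<zeta> ^ k * (\<Sum>\<chi>\<in>S. v \<chi> * \<chi> (rep ?R))"
          unfolding sum_distrib_left
        proof (rule sum.cong[OF refl])
          fix \<chi> assume "\<chi> \<in> S"
          then have "\<chi> g = \<zeta> ^ k * \<chi> (rep ?R)" using arg_cong[OF k, of \<chi>] pow[OF _ repR] by metis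
          then show "v \<chi> * \<chi> g = \<zeta> ^ k * (v \<chi> * \<chi> (rep ?R))" by simp
        qed
        also have "\<dots> = 0" using v(2) R by simp
        finally show ?thesis .
      qed
      obtain \<psi> where \<psi>: "\<psi> \<in> S" "v \<psi> \<noteq> 0" using v(1) by blast
      \<comment> \<open>Pairing the relation with \<open>\<psi>\<close> isolates the coefficient of \<open>\<psi>\<close>.\<close>
      have "0 = (\<Sum>g\<in>carrier G. (\<Sum>\<chi>\<in>S. v \<chi> * \<chi> g) * \<psi> (inv g))" using zero by simp
      also have "\<dots> = (\<Sum>\<chi>\<in>S. v \<chi> * char_pairing G \<chi> \<psi>)"
        unfolding char_pairing_def sum_distrib_left sum_distrib_right
        by (subst sum.swap) (simp add: mult.assoc)
      also have "\<dots> = (\<Sum>\<chi>\<in>S. if \<chi> = \<psi> then v \<psi> * of_nat (card (carrier G)) else 0)"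
        using S C \<psi>(1) by (intro sum.cong refl) (subst Irr_char_pairing[OF G], auto)
      also have "\<dots> = v \<psi> * of_nat (card (carrier G))" using \<psi> S by simp
      finally have "card (carrier G) = 0" using \<psi>(2) by simp
      then show False using fin one_closed by auto
    qed
  qed
qed

section \<open>Commuting elements in nilpotent groups\<close>

text \<open>
  When \<open>w = [x, y]\<close> commutes with \<open>x\<close> and \<open>y\<close>, the commutator of \<open>x\<^sup>k\<close> and \<open>y\<close> is \<open>w\<^sup>k\<close>, and likewise for powers
  of \<open>y\<close>. So the order of \<open>w\<close> divides both \<open>a\<close> and \<open>b\<close>.
\<close>

lemma (in group) commutator_trivial_of_coprime_powers:
  assumes carr: "x \<in> carrier G" "y \<in> carrier G" "w \<in> carrier G"
    and xy: "x \<otimes> y = w \<otimes> (y \<otimes> x)"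
    and wx: "w \<otimes> x = x \<otimes> w" and wy: "w \<otimes> y = y \<otimes> w"
    and pow: "x [^] (a::nat) = \<one>" "y [^] (b::nat) = \<one>" and "coprime a b"
  shows "w = \<one>"
proof -
  have xk: "x [^] k \<otimes> y = w [^] k \<otimes> (y \<otimes> x [^] k)" for k :: nat
  proof (induction k)
    case (Suc k)
    have "x [^] Suc k \<otimes> y = x [^] k \<otimes> (x \<otimes> y)" using carr by (simp add: m_assoc)
    also have "\<dots> = (x [^] k \<otimes> w) \<otimes> (y \<otimes> x)" using carr by (simp add: xy m_assoc)
    also have "x [^] k \<otimes> w = w \<otimes> x [^] k"
      using group_commutes_pow[of x w k] carr wx by metis
    also have "w \<otimes> x [^] k \<otimes> (y \<otimes> x) = w \<otimes> (x [^] k \<otimes> y) \<otimes> x" using carr by (simp add: m_assoc)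
    also have "\<dots> = w \<otimes> (w [^] k \<otimes> (y \<otimes> x [^] k)) \<otimes> x" by (simp add: Suc)
    also have "\<dots> = w [^] Suc k \<otimes> (y \<otimes> x [^] Suc k)"
      using carr nat_pow_Suc2[of w k] by (simp add: m_assoc)
    finally show ?case .
  qed (use carr in simp)
  have yk: "x \<otimes> y [^] k = w [^] k \<otimes> (y [^] k \<otimes> x)" for k :: nat
  proof (induction k)
    case (Suc k)
    have "x \<otimes> y [^] Suc k = (x \<otimes> y [^] k) \<otimes> y" using carr by (simp add: m_assoc)
    also have "\<dots> = w [^] k \<otimes> (y [^] k \<otimes> (x \<otimes> y))" using carr by (simp add: Suc m_assoc)
    also have "\<dots> = w [^] k \<otimes> ((y [^] k \<otimes> w) \<otimes> (y \<otimes> x))" using carr by (simp add: xy m_assoc)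
    also have "y [^] k \<otimes> w = w \<otimes> y [^] k"
      using group_commutes_pow[of y w k] carr wy by metis
    also have "w [^] k \<otimes> ((w \<otimes> y [^] k) \<otimes> (y \<otimes> x)) = w [^] Suc k \<otimes> (y [^] Suc k \<otimes> x)"
      using carr by (simp add: m_assoc)
    finally show ?case .
  qed (use carr in simp)
  have "w [^] a \<otimes> y = \<one> \<otimes> y" using xk[of a] pow carr by simp
  then have "w [^] a = \<one>" using carr by simp
  moreover have "w [^] b \<otimes> x = \<one> \<otimes> x" using yk[of b] pow carr by simp
  then have "w [^] b = \<one>" using carr by simp
  ultimately have "ord w dvd a" "ord w dvd b" using carr pow_eq_id by simp_all
  then have "ord w = 1" using \<open>coprime a b\<close> coprime_common_divisor_nat by blast
  then show ?thesis using carr ord_eq_1 by simp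
qed

text \<open>
  The generating set of each term is closed under conjugation because conjugation is an automorphism.
\<close>

lemma lower_central_series_normal:
  assumes "group G"
  shows "lower_central_series G k \<lhd> G"
proof -
  interpret group G by fact
  show ?thesis
  proof (induction k)
    case 0
    show ?case by (auto intro!: normal_invI subgroup_self)
  next
    case (Suc k)
    then have sub: "lower_central_series G k \<subseteq> carrier G"
      using normal_imp_subgroup subgroup.subset by blast
    show ?case
      unfolding lower_central_series.simps
    proof (rule normal_generateI)
      fix c g
      assume "c \<in> (\<Union>x\<in>lower_central_series G k. \<Union>y\<in>carrier G.
        {x \<otimes>\<^bsub>G\<^esub> y \<otimes>\<^bsub>G\<^esub> inv\<^bsub>G\<^esub> x \<otimes>\<^bsub>G\<^esub> inv\<^bsub>G\<^esub> y})" and g: "g \<in> carrier G"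
      then obtain x y where xy: "x \<in> lower_central_series G k" "y \<in> carrier G"
        and c: "c = x \<otimes>\<^bsub>G\<^esub> y \<otimes>\<^bsub>G\<^esub> inv\<^bsub>G\<^esub> x \<otimes>\<^bsub>G\<^esub> inv\<^bsub>G\<^esub> y" by auto
      define conj where "conj u = g \<otimes>\<^bsub>G\<^esub> u \<otimes>\<^bsub>G\<^esub> inv\<^bsub>G\<^esub> g" for u
      have x: "x \<in> carrier G" using xy sub by blast
      have cm: "conj (u \<otimes>\<^bsub>G\<^esub> v) = conj u \<otimes>\<^bsub>G\<^esub> conj v" if "u \<in> carrier G" "v \<in> carrier G" for u v
        using that g by (simp add: conj_def m_assoc inv_solve_left)
      have ci: "conj (inv\<^bsub>G\<^esub> u) = inv\<^bsub>G\<^esub> (conj u)" if "u \<in> carrier G" for u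
        using that g by (simp add: conj_def inv_mult_group m_assoc)
      have cc: "conj u \<in> carrier G" if "u \<in> carrier G" for u using that g by (simp add: conj_def)
      have "conj c = conj x \<otimes>\<^bsub>G\<^esub> conj y \<otimes>\<^bsub>G\<^esub> inv\<^bsub>G\<^esub> conj x \<otimes>\<^bsub>G\<^esub> inv\<^bsub>G\<^esub> conj y"
        using x xy(2) by (simp add: c cm ci)
      moreover have "conj x \<in> lower_central_series G k"
        unfolding conj_def by (rule normal.inv_op_closed2[OF Suc g xy(1)])
      ultimately show "g \<otimes>\<^bsub>G\<^esub> c \<otimes>\<^bsub>G\<^esub> inv\<^bsub>G\<^esub> g \<in> (\<Union>x\<in>lower_central_series G k. \<Union>y\<in>carrier G.
        {x \<otimes>\<^bsub>G\<^esub> y \<otimes>\<^bsub>G\<^esub> inv\<^bsub>G\<^esub> x \<otimes>\<^bsub>G\<^esub> inv\<^bsub>G\<^esub> y})"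
        using cc[OF xy(2)] unfolding conj_def by blast
    qed (use sub in auto)
  qed
qed

lemma lower_central_series_commutator:
  assumes "group G" "x \<in> lower_central_series G k" "y \<in> carrier G"
  shows "x \<otimes>\<^bsub>G\<^esub> y \<otimes>\<^bsub>G\<^esub> inv\<^bsub>G\<^esub> x \<otimes>\<^bsub>G\<^esub> inv\<^bsub>G\<^esub> y \<in> lower_central_series G (Suc k)"
  using assms unfolding lower_central_series.simps by (blast intro: generate.incl)

lemma (in group) commutator_eq:
  assumes "x \<in> carrier G" "y \<in> carrier G"
  shows "x \<otimes> y \<otimes> inv x \<otimes> inv y = (x \<otimes> y) \<otimes> inv (y \<otimes> x)"
    and "x \<otimes> y = x \<otimes> y \<otimes> inv x \<otimes> inv y \<otimes> (y \<otimes> x)"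
proof -
  show eq: "x \<otimes> y \<otimes> inv x \<otimes> inv y = (x \<otimes> y) \<otimes> inv (y \<otimes> x)"
    using assms by (simp add: inv_mult_group m_assoc)
  show "x \<otimes> y = x \<otimes> y \<otimes> inv x \<otimes> inv y \<otimes> (y \<otimes> x)"
    unfolding eq using assms by (simp add: m_assoc del: inv_mult_group)
qed

lemma (in group) coset_eq_of_commutator_mem:
  assumes "subgroup H G" "x \<in> carrier G" "y \<in> carrier G" "x \<otimes> y \<otimes> inv x \<otimes> inv y \<in> H"
  shows "H #> (x \<otimes> y) = H #> (y \<otimes> x)"
proof -
  have "x \<otimes> y \<in> H #> (y \<otimes> x)"
    using assms subgroup.rcos_module[OF assms(1) is_group, of "y \<otimes> x" "x \<otimes> y"] by (simp add: commutator_eq(1))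
  then show ?thesis using repr_independence[OF _ _ assms(1)] assms by (metis m_closed)
qed

text \<open>
  The commutator \<open>w\<close> of two elements of coprime order lies in every term of the lower central series:
  if it lies in one term, it is central modulo the next term, where
  \<open>commutator_trivial_of_coprime_powers\<close> makes it trivial. Hence \<open>w\<close> is the identity.
\<close>

lemma coprime_ord_commute:
  fixes G (structure)
  assumes G: "group G" and nil: "nilpotent_group G"
    and x: "x \<in> carrier G" and y: "y \<in> carrier G"
    and cop: "coprime (group.ord G x) (group.ord G y)"
  shows "x \<otimes> y = y \<otimes> x"
proof -
  interpret group G by fact
  define w where "w = x \<otimes> y \<otimes> inv x \<otimes> inv y"
  have w: "w \<in> carrier G" using x y by (simp add: w_def)
  have xy: "x \<otimes> y = w \<otimes> (y \<otimes> x)" unfolding w_def by (rule commutator_eq(2)[OF x y])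
  have "w \<in> lower_central_series G k" for k
  proof (induction k)
    case 0
    show ?case using w by simp
  next
    case (Suc k)
    define N where "N = lower_central_series G (Suc k)"
    have N: "N \<lhd> G" unfolding N_def by (rule lower_central_series_normal[OF G])
    interpret N: normal N G by (rule N)
    interpret Q: group "G Mod N" by (rule N.factorgroup_is_group)
    define q where "q u = N #> u" for u
    have q: "q \<in> hom G (G Mod N)" unfolding q_def by (rule N.r_coset_hom_Mod)
    interpret q: group_hom G "G Mod N" q by unfold_locales (rule q)
    have central: "q w \<otimes>\<^bsub>G Mod N\<^esub> q u = q u \<otimes>\<^bsub>G Mod N\<^esub> q w" if u: "u \<in> carrier G" for u
    proof -
      have "w \<otimes> u \<otimes> inv w \<otimes> inv u \<in> N"
        unfolding N_def by (rule lower_central_series_commutator[OF G Suc u])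
      then have "q (w \<otimes> u) = q (u \<otimes> w)"
        unfolding q_def by (rule coset_eq_of_commutator_mem[OF normal_imp_subgroup[OF N] w u])
      then show ?thesis using w u by simp
    qed
    have "q w = \<one>\<^bsub>G Mod N\<^esub>"
    proof (rule Q.commutator_trivial_of_coprime_powers)
      have "q (x \<otimes> y) = q (w \<otimes> (y \<otimes> x))" using xy by (rule arg_cong)
      then show "q x \<otimes>\<^bsub>G Mod N\<^esub> q y = q w \<otimes>\<^bsub>G Mod N\<^esub> (q y \<otimes>\<^bsub>G Mod N\<^esub> q x)"
        using x y w by (metis q.hom_mult m_closed)
      show "q x [^]\<^bsub>G Mod N\<^esub> ord x = \<one>\<^bsub>G Mod N\<^esub>" "q y [^]\<^bsub>G Mod N\<^esub> ord y = \<one>\<^bsub>G Mod N\<^esub>"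
        using x y q.hom_nat_pow[of x "ord x"] q.hom_nat_pow[of y "ord y"] q.hom_one by (metis pow_ord_eq_1)+
    qed (use x y w central cop in \<open>simp_all only: q.hom_closed\<close>)
    then have "N #> w = N" by (simp add: q_def FactGroup_def)
    then have "w \<in> N" using coset_join1[of N w] w normal_imp_subgroup[OF N] by blast
    then show ?case by (simp only: N_def)
  qed
  moreover obtain k where "lower_central_series G k = {\<one>}" using nil by (auto simp: nilpotent_group_def)
  ultimately have "w = \<one>" by blast
  then show ?thesis using x y xy by simp
qed

section \<open>Sylow subgroups and a maximal central cyclic subgroup\<close>

lemma (in group) card_subgroup_dvd:
  assumes "subgroup H G" "subgroup C G" "H \<subseteq> C"
  shows "card H dvd card C"
proof -
  interpret C: group "G\<lparr>carrier := C\<rparr>" using assms(2) by (rule subgroup_imp_group)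
  have "subgroup H (G\<lparr>carrier := C\<rparr>)" using assms subgroup_incl by blast
  from C.lagrange[OF this] have "card C = card (rcosets\<^bsub>G\<lparr>carrier := C\<rparr>\<^esub> H) * card H"
    by (simp add: Coset.order_def)
  then show ?thesis by simp
qed

text \<open>
  The order of such a subgroup is divisible by the full power of every prime in \<open>|G|\<close>. In a nilpotent group
  this is how elements are shown to be central: their centralizers contain a Sylow subgroup for each prime.
\<close>

lemma (in group) subgroup_full_if_locally_full:
  assumes fin: "finite (carrier G)" and C: "subgroup C G"
    and loc: "\<And>p. Factorial_Ring.prime p \<Longrightarrow> p dvd Coset.order G \<Longrightarrow>
      \<exists>H. subgroup H G \<and> H \<subseteq> C \<and> p ^ multiplicity p (Coset.order G) dvd card H"
  shows "C = carrier G"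
proof -
  have finC: "finite C" using fin C subgroup.subset finite_subset by metis
  have C0: "card C \<noteq> 0" using finC subgroup.one_closed[OF C] by auto
  have n0: "Coset.order G \<noteq> 0" using fin order_gt_0_iff_finite by simp
  have "Coset.order G dvd card C"
  proof (rule multiplicity_le_imp_dvd[OF n0])
    fix p :: nat assume p: "Factorial_Ring.prime p"
    show "multiplicity p (Coset.order G) \<le> multiplicity p (card C)"
    proof (cases "p dvd Coset.order G")
      case True
      then have "p ^ multiplicity p (Coset.order G) dvd card C"
        using loc[OF p] card_subgroup_dvd[OF _ C] dvd_trans by blast
      then show ?thesis using C0 p by (intro multiplicity_geI) auto
    qed (simp add: not_dvd_imp_multiplicity_0)
  qed
  then have "card (carrier G) \<le> card C" using C0 by (simp add: Coset.order_def dvd_imp_le)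
  then show ?thesis using fin C subgroup.subset card_seteq by metis
qed

lemma (in group) sylow_exists:
  assumes "finite (carrier G)" "Factorial_Ring.prime p"
  shows "\<exists>P. subgroup P G \<and> card P = p ^ multiplicity p (Coset.order G)"
  using sylow_thm[OF assms(2) is_group _ assms(1)] multiplicity_dvd[of p "Coset.order G"] by (auto elim: dvdE)

lemma (in group) ord_dvd_card_subgroup:
  assumes "subgroup P G" "x \<in> P"
  shows "ord x dvd card P"
proof -
  interpret P: group "G\<lparr>carrier := P\<rparr>" using assms(1) by (rule subgroup_imp_group)
  have "x [^] card P = \<one>"
    using P.pow_order_eq_1[of x] assms(2) nat_pow_consistent[of x "card P" P] by (simp add: Coset.order_def)
  then show ?thesis using assms subgroup.mem_carrier pow_eq_id by metis
qed

lemma (in group) ord_mult_coprime: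
  assumes x: "x \<in> carrier G" and y: "y \<in> carrier G" and xy: "x \<otimes> y = y \<otimes> x"
    and cop: "coprime (ord x) (ord y)"
  shows "ord (x \<otimes> y) = ord x * ord y"
proof (rule dvd_antisym)
  let ?e = "ord (x \<otimes> y)"
  show "?e dvd ord x * ord y" by (rule ord_mul_divides[OF xy x y])
  have e: "x [^] (?e * k) \<otimes> y [^] (?e * k) = \<one>" for k
  proof -
    have "x [^] (?e * k) \<otimes> y [^] (?e * k) = (x \<otimes> y) [^] (?e * k)"
      by (rule pow_mult_distrib[symmetric, OF xy x y])
    also have "\<dots> = \<one>" using x y pow_eq_id[of "x \<otimes> y"] by simp
    finally show ?thesis .
  qed
  have "y [^] (?e * ord y) = \<one>" "x [^] (?e * ord x) = \<one>" using x y pow_eq_id by simp_all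
  then have "x [^] (?e * ord y) = \<one>" "y [^] (?e * ord x) = \<one>"
    using e[of "ord y"] e[of "ord x"] x y by simp_all
  then have "ord x dvd ?e * ord y" "ord y dvd ?e * ord x" using x y pow_eq_id by simp_all
  then have "ord x dvd ?e" "ord y dvd ?e"
    using cop by (simp_all add: coprime_dvd_mult_left_iff coprime_commute)
  then show "ord x * ord y dvd ?e" using cop by (simp add: divides_mult)
qed

lemma prime_power_factor_coprime:
  fixes n p m :: nat
  assumes p: "Factorial_Ring.prime p" and n: "n \<noteq> 0" and m: "m dvd n" "\<not> p dvd m"
  obtains k where "n = m * p ^ multiplicity p n * k" "\<not> p dvd k"
proof -
  have "\<not> is_unit p" using p by auto
  then obtain k' where k': "n = p ^ multiplicity p n * k'" "\<not> p dvd k'"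
    using multiplicity_decompose'[OF n] by blast
  have "coprime m (p ^ multiplicity p n)"
    using p m(2) by (meson coprime_commute coprime_power_right_iff prime_imp_coprime)
  then have "m dvd k'" using m(1) k'(1) by (metis coprime_dvd_mult_right_iff)
  then obtain k where k: "k' = m * k" by (rule dvdE)
  show ?thesis
  proof (rule that)
    show "n = m * p ^ multiplicity p n * k" using k'(1) k by (simp add: ac_simps)
    show "\<not> p dvd k" using k'(2) k by auto
  qed
qed

text \<open>
  Among the elements whose order \<open>m\<close> is coprime to \<open>n / m\<close>, with \<open>n = |G|\<close>, choose one of largest order. If for some prime
  \<open>p\<close> dividing \<open>n / m\<close> there were an element \<open>y\<close> generating a Sylow \<open>p\<close>-subgroup, then \<open>z y\<close> would be a larger choice.
  So \<open>\<langle>z\<rangle>\<close> is the product of the cyclic Sylow subgroups of \<open>G\<close>.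
\<close>

lemma maximal_unitary_element:
  fixes G (structure)
  assumes G: "group G" and fin: "finite (carrier G)" and nil: "nilpotent_group G"
  shows "\<exists>z\<in>carrier G. coprime (group.ord G z) (Coset.order G div group.ord G z) \<and>
    (\<forall>p. Factorial_Ring.prime p \<longrightarrow> p dvd Coset.order G div group.ord G z \<longrightarrow>
      (\<forall>y\<in>carrier G. group.ord G y \<noteq> p ^ multiplicity p (Coset.order G)))"
proof -
  interpret group G by fact
  let ?n = "Coset.order G"
  have n0: "?n \<noteq> 0" using fin order_gt_0_iff_finite by simp
  define U where "U = {z \<in> carrier G. coprime (ord z) (?n div ord z)}"
  have "\<one> \<in> U" by (simp add: U_def)
  moreover have "finite U" using fin by (simp add: U_def)
  ultimately have "ord ` U \<noteq> {}" "finite (ord ` U)" by auto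
  then have "Max (ord ` U) \<in> ord ` U" and le: "\<And>u. u \<in> U \<Longrightarrow> ord u \<le> Max (ord ` U)"
    using Max_in Max_ge by auto
  then obtain z where zU: "z \<in> U" and max: "\<And>u. u \<in> U \<Longrightarrow> ord u \<le> ord z" by (metis imageE)
  then have z: "z \<in> carrier G" and cop: "coprime (ord z) (?n div ord z)" by (auto simp: U_def)
  have zn: "ord z dvd ?n" by (rule ord_dvd_group_order[OF z])
  have z0: "ord z > 0" using zn n0 by (auto intro: gr0I)
  have "ord y \<noteq> p ^ multiplicity p ?n"
    if p: "Factorial_Ring.prime p" "p dvd ?n div ord z" and y: "y \<in> carrier G" for p y
  proof
    assume oy: "ord y = p ^ multiplicity p ?n"
    have "\<not> p dvd ord z" using cop p coprime_common_divisor_nat not_prime_1 by metis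
    then obtain k where k: "?n = ord z * p ^ multiplicity p ?n * k" "\<not> p dvd k"
      using prime_power_factor_coprime[OF p(1) n0 zn] by metis
    have "coprime (ord z) (ord y)"
      unfolding oy using p(1) \<open>\<not> p dvd ord z\<close> by (meson coprime_commute coprime_power_right_iff prime_imp_coprime)
    then have ozy: "ord (z \<otimes> y) = ord z * ord y"
      using ord_mult_coprime[OF z y] coprime_ord_commute[OF G nil z y] by blast
    have h: "?n div ord z = p ^ multiplicity p ?n * k"
      using k(1) z0 by (metis mult.assoc nonzero_mult_div_cancel_left less_not_refl)
    have "?n = (ord z * ord y) * k" using k(1) oy by simp
    then have h': "?n div (ord z * ord y) = k"
      using z0 oy p(1) by (metis nonzero_mult_div_cancel_left n0 mult_eq_0_iff)
    have "coprime (ord z) k" using cop unfolding h by simp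
    moreover have "coprime (ord y) k"
      unfolding oy using p(1) k(2) by (meson coprime_power_left_iff prime_imp_coprime)
    ultimately have "z \<otimes> y \<in> U" using z y ozy h' by (simp add: U_def)
    then have "ord z * ord y \<le> ord z" using max ozy by metis
    then have "ord y \<le> 1" using z0 by simp
    moreover have "p dvd ?n" using p(2) zn by (metis dvd_div_mult_self dvd_mult2)
    then have "multiplicity p ?n > 0" using p(1) n0 by (simp add: prime_multiplicity_gt_zero_iff)
    then have "ord y > 1" unfolding oy using p(1) prime_gt_1_nat one_less_power by blast
    ultimately show False by simp
  qed
  then show ?thesis using z cop by blast
qed

text \<open>
  For \<open>p\<close> dividing the order of \<open>z\<close>, the cyclic group \<open>\<langle>z\<rangle>\<close> itself contains a Sylow \<open>p\<close>-subgroup; for any other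
  \<open>p\<close>, the elements of a Sylow \<open>p\<close>-subgroup have order coprime to that of \<open>z\<close>.
\<close>

lemma unitary_element_central:
  fixes G (structure)
  assumes G: "group G" and fin: "finite (carrier G)" and nil: "nilpotent_group G"
    and z: "z \<in> carrier G" and cop: "coprime (group.ord G z) (Coset.order G div group.ord G z)"
    and g: "g \<in> carrier G"
  shows "g \<otimes> z = z \<otimes> g"
proof -
  interpret group G by fact
  let ?n = "Coset.order G"
  define C where "C = {g \<in> carrier G. g \<otimes> z = z \<otimes> g}"
  have zn: "ord z dvd ?n" by (rule ord_dvd_group_order[OF z])
  have C: "subgroup C G"
  proof (rule subgroupI)
    show "C \<noteq> {}" using z by (auto simp: C_def)
    fix a assume a: "a \<in> C"
    then have ac: "a \<in> carrier G" "a \<otimes> z = z \<otimes> a" by (auto simp: C_def)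
    have "inv a \<otimes> z = inv a \<otimes> (z \<otimes> a) \<otimes> inv a" using ac z by (simp add: m_assoc)
    also have "\<dots> = inv a \<otimes> (a \<otimes> z) \<otimes> inv a" by (simp only: ac(2))
    also have "\<dots> = z \<otimes> inv a" using ac(1) z by (simp add: m_assoc[symmetric])
    finally show "inv a \<in> C" using ac by (simp add: C_def)
    fix b assume b: "b \<in> C"
    then have bc: "b \<in> carrier G" "b \<otimes> z = z \<otimes> b" by (auto simp: C_def)
    have "(a \<otimes> b) \<otimes> z = a \<otimes> (z \<otimes> b)" using ac bc z by (simp add: m_assoc)
    also have "\<dots> = z \<otimes> (a \<otimes> b)" using ac bc(1) z by (simp add: m_assoc[symmetric])
    finally show "a \<otimes> b \<in> C" using ac bc by (simp add: C_def)
  qed (auto simp: C_def)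
  have "C = carrier G"
  proof (rule subgroup_full_if_locally_full[OF fin C])
    fix p assume p: "Factorial_Ring.prime p" "p dvd ?n"
    show "\<exists>H. subgroup H G \<and> H \<subseteq> C \<and> p ^ multiplicity p ?n dvd card H"
    proof (cases "p dvd ord z")
      case True
      then have "\<not> p dvd ?n div ord z"
        using cop p coprime_common_divisor_nat not_prime_1 by metis
      then have "coprime (p ^ multiplicity p ?n) (?n div ord z)"
        using p(1) by (meson coprime_power_left_iff prime_imp_coprime)
      moreover have "p ^ multiplicity p ?n dvd ord z * (?n div ord z)"
        using zn multiplicity_dvd[of p ?n] by simp
      ultimately have "p ^ multiplicity p ?n dvd ord z" by (simp add: coprime_dvd_mult_left_iff)
      moreover have "subgroup (generate G {z}) G" using z by (intro generate_is_subgroup) auto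
      moreover have "generate G {z} \<subseteq> C"
        using z by (intro generate_subgroup_incl C) (auto simp: C_def)
      ultimately show ?thesis using generate_pow_card[OF z] by metis
    next
      case False
      obtain P where P: "subgroup P G" "card P = p ^ multiplicity p ?n"
        using sylow_exists[OF fin p(1)] by blast
      have "P \<subseteq> C"
      proof
        fix x assume x: "x \<in> P"
        then have xc: "x \<in> carrier G" using P(1) subgroup.mem_carrier by metis
        have "coprime (ord z) (p ^ multiplicity p ?n)"
          using p(1) False by (meson coprime_commute coprime_power_right_iff prime_imp_coprime)
        moreover have "ord x dvd p ^ multiplicity p ?n"
          using ord_dvd_card_subgroup[OF P(1) x] P(2) by simp
        ultimately have "coprime (ord x) (ord z)"
          by (meson coprime_commute coprime_divisors dvd_refl)
        then show "x \<in> C" using coprime_ord_commute[OF G nil xc z] xc by (simp add: C_def)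
      qed
      then show ?thesis using P by auto
    qed
  qed
  then show ?thesis using g by (auto simp: C_def)
qed

section \<open>Prime divisors of kernels and degrees\<close>

definition rep_kernel :: "('a, 'b) monoid_scheme \<Rightarrow> nat \<Rightarrow> ('a \<Rightarrow> complex mat) \<Rightarrow> 'a set" where
  "rep_kernel G n \<rho> = {g \<in> carrier G. \<rho> g = 1\<^sub>m n}"

lemma power_coprime_eq_one:
  fixes c :: "'a :: monoid_mult"
  assumes "c ^ s = 1" "c ^ t = 1" "coprime s t"
  shows "c = 1"
proof (cases "t = 1")
  case False
  then obtain x y where xy: "s * x = t * y + 1" using coprime_bezout_strong[OF assms(3)] by blast
  have "1 = c ^ (s * x)" by (simp add: power_mult assms(1))
  also have "\<dots> = c" unfolding xy by (simp add: power_add power_mult assms(2))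
  finally show ?thesis by simp
qed (use assms in simp)

lemma (in group) rep_commute_centralizer:
  assumes \<rho>: "matrix_rep G n \<rho>" and x: "x \<in> carrier G"
  shows "subgroup {g \<in> carrier G. \<rho> x * \<rho> g = \<rho> g * \<rho> x} G" (is "subgroup ?C G")
proof (rule subgroupI)
  note [simp] = matrix_rep_carrier[OF \<rho>]
  note mult = matrix_rep_mult[OF \<rho>]
  have X: "\<rho> x \<in> carrier_mat n n" using x by simp
  show "?C \<noteq> {}" using x by blast
  fix a assume a: "a \<in> ?C"
  then have ac: "a \<in> carrier G" "\<rho> x * \<rho> a = \<rho> a * \<rho> x" by auto
  have A: "\<rho> a \<in> carrier_mat n n" and A': "\<rho> (inv a) \<in> carrier_mat n n" using ac by simp_all
  have inv: "\<rho> a * \<rho> (inv a) = 1\<^sub>m n" "\<rho> (inv a) * \<rho> a = 1\<^sub>m n"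
    using matrix_rep_inv[OF is_group \<rho> ac(1)] by auto
  have "\<rho> x * \<rho> (inv a) = (\<rho> (inv a) * \<rho> a) * (\<rho> x * \<rho> (inv a))"
    unfolding inv using X A' by simp
  also have "\<dots> = \<rho> (inv a) * (\<rho> a * (\<rho> x * \<rho> (inv a)))"
    using X A A' by (intro assoc_mult_mat[of _ n n _ n _ n]) auto
  also have "\<rho> a * (\<rho> x * \<rho> (inv a)) = \<rho> x * (\<rho> a * \<rho> (inv a))"
    using assoc_mult_mat[OF A X A'] assoc_mult_mat[OF X A A'] ac(2) by metis
  also have "\<dots> = \<rho> x" unfolding inv using X by simp
  finally show "inv a \<in> ?C" using ac by simp
  fix b assume b: "b \<in> ?C"
  then have bc: "b \<in> carrier G" "\<rho> x * \<rho> b = \<rho> b * \<rho> x" by auto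
  have B: "\<rho> b \<in> carrier_mat n n" using bc by simp
  have "\<rho> x * (\<rho> a * \<rho> b) = (\<rho> a * \<rho> b) * \<rho> x"
    using assoc_mult_mat[OF X A B] assoc_mult_mat[OF A X B] assoc_mult_mat[OF A B X] ac(2) bc(2) by metis
  then show "a \<otimes> b \<in> ?C" using ac bc by (simp add: mult)
qed auto

lemma rep_pow_scalar:
  fixes G (structure)
  assumes G: "group G" and \<rho>: "matrix_rep G n \<rho>" and x: "x \<in> carrier G" and c: "\<rho> x = c \<cdot>\<^sub>m 1\<^sub>m n"
  shows "\<rho> (x [^] (k::nat)) = c ^ k \<cdot>\<^sub>m 1\<^sub>m n"
proof -
  interpret group G by fact
  show ?thesis
  proof (induction k)
    case 0
    show ?case using matrix_rep_one[OF G \<rho>] by (auto intro!: eq_matI)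
  next
    case (Suc k)
    have "\<rho> (x [^] Suc k) = (c ^ k \<cdot>\<^sub>m 1\<^sub>m n) * (c \<cdot>\<^sub>m 1\<^sub>m n)"
      using x by (simp add: matrix_rep_mult[OF \<rho>] Suc c)
    also have "\<dots> = c ^ k \<cdot>\<^sub>m (c \<cdot>\<^sub>m 1\<^sub>m n)"
      by (subst mult_smult_assoc_mat[of _ n n _ n]) auto
    also have "\<dots> = c ^ Suc k \<cdot>\<^sub>m 1\<^sub>m n" by (auto intro!: eq_matI)
    finally show ?case .
  qed
qed

lemma smult_one_mat_eq_one_iff:
  assumes "0 < n"
  shows "c \<cdot>\<^sub>m 1\<^sub>m n = 1\<^sub>m n \<longleftrightarrow> c = (1::complex)"
proof
  assume "c \<cdot>\<^sub>m 1\<^sub>m n = 1\<^sub>m n"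
  then have "(c \<cdot>\<^sub>m 1\<^sub>m n) $$ (0, 0) = 1\<^sub>m n $$ (0, 0)" by (rule arg_cong)
  then show "c = 1" using assms by simp
qed (auto intro!: eq_matI)

lemma rep_kernel_subgroup:
  fixes G (structure)
  assumes G: "group G" and \<rho>: "matrix_rep G n \<rho>"
  shows "subgroup (rep_kernel G n \<rho>) G"
proof -
  interpret group G by fact
  show ?thesis
  proof (rule subgroupI)
    show "rep_kernel G n \<rho> \<noteq> {}" using matrix_rep_one[OF G \<rho>] by (auto simp: rep_kernel_def)
    fix a assume a: "a \<in> rep_kernel G n \<rho>"
    then have "a \<in> carrier G" "\<rho> a = 1\<^sub>m n" by (auto simp: rep_kernel_def)
    then have "\<rho> (inv a) = 1\<^sub>m n"
      using matrix_rep_inv(1)[OF G \<rho>, of a] left_mult_one_mat[OF matrix_rep_carrier[OF \<rho>, of "inv a"]] by simp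
    then show "inv a \<in> rep_kernel G n \<rho>" using a by (simp add: rep_kernel_def)
    fix b assume "b \<in> rep_kernel G n \<rho>"
    then show "a \<otimes> b \<in> rep_kernel G n \<rho>"
      using a by (auto simp: rep_kernel_def matrix_rep_mult[OF \<rho>])
  qed (auto simp: rep_kernel_def)
qed

text \<open>
  The centralizer of \<open>\<rho> x\<close> contains \<open>P\<close> by assumption and the Sylow subgroups for the other primes because \<open>G\<close>
  is nilpotent. So \<open>\<rho> x\<close> commutes with the whole image and Schur's lemma applies.
\<close>

lemma sylow_element_scalar:
  fixes G (structure)
  assumes G: "group G" and fin: "finite (carrier G)" and nil: "nilpotent_group G"
    and irr: "irreducible_rep G n \<rho>" and p: "Factorial_Ring.prime p"
    and P: "subgroup P G" "card P = p ^ multiplicity p (Coset.order G)"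
    and x: "x \<in> P" and comm: "\<And>y. y \<in> P \<Longrightarrow> \<rho> x * \<rho> y = \<rho> y * \<rho> x"
  shows "\<exists>c. \<rho> x = c \<cdot>\<^sub>m 1\<^sub>m n \<and> (\<forall>k. x [^] (k::nat) = \<one> \<longrightarrow> c ^ k = 1)"
proof -
  interpret group G by fact
  note \<rho> = irreducible_rep_matrix_rep[OF irr]
  let ?C = "{g \<in> carrier G. \<rho> x * \<rho> g = \<rho> g * \<rho> x}"
  have xc: "x \<in> carrier G" using P(1) x subgroup.mem_carrier by metis
  have "?C = carrier G"
  proof (rule subgroup_full_if_locally_full[OF fin rep_commute_centralizer[OF \<rho> xc]])
    fix q assume q: "Factorial_Ring.prime q" "q dvd Coset.order G"
    show "\<exists>H. subgroup H G \<and> H \<subseteq> ?C \<and> q ^ multiplicity q (Coset.order G) dvd card H"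
    proof (cases "q = p")
      case True
      have "P \<subseteq> ?C" using comm subgroup.mem_carrier[OF P(1)] by blast
      then show ?thesis using P True by auto
    next
      case False
      obtain Q where Q: "subgroup Q G" "card Q = q ^ multiplicity q (Coset.order G)"
        using sylow_exists[OF fin q(1)] by blast
      have cop: "coprime (card P) (card Q)"
        unfolding P Q using p q(1) False by (simp add: primes_coprime)
      have "Q \<subseteq> ?C"
      proof
        fix y assume y: "y \<in> Q"
        then have yc: "y \<in> carrier G" using Q(1) subgroup.mem_carrier by metis
        have "coprime (ord x) (ord y)"
          using coprime_divisors[OF ord_dvd_card_subgroup[OF P(1) x] ord_dvd_card_subgroup[OF Q(1) y] cop] .
        then have "x \<otimes> y = y \<otimes> x" by (rule coprime_ord_commute[OF G nil xc yc])
        then show "y \<in> ?C" using xc yc matrix_rep_mult[OF \<rho>] by (metis (mono_tags) mem_Collect_eq)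
      qed
      then show ?thesis using Q by auto
    qed
  qed
  then have "\<rho> x * \<rho> g = \<rho> g * \<rho> x" if "g \<in> carrier G" for g using that by blast
  then obtain c where c: "\<rho> x = c \<cdot>\<^sub>m 1\<^sub>m n"
    using schur_scalar[OF irr matrix_rep_carrier[OF \<rho> xc]] by blast
  have "c ^ k = 1" if k: "x [^] k = \<one>" for k :: nat
    using rep_pow_scalar[OF G \<rho> xc c, of k] k matrix_rep_one[OF G \<rho>]
      smult_one_mat_eq_one_iff[OF irreducible_rep_degree_pos[OF irr]] by metis
  then show ?thesis using c by blast
qed

text \<open>
  Take determinants on both sides of \<open>A B = c B A\<close>.
\<close>

lemma scalar_commutator_root_of_unity:
  fixes A B :: "complex mat"
  assumes A: "A \<in> carrier_mat n n" "det A \<noteq> 0" and B: "B \<in> carrier_mat n n" "det B \<noteq> 0"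
    and AB: "A * B = c \<cdot>\<^sub>m (B * A)"
  shows "c ^ n = 1"
proof -
  have "det A * det B = det (A * B)" by (rule det_mult[OF A(1) B(1), symmetric])
  also have "\<dots> = c ^ n * (det B * det A)"
    unfolding AB using A B by (simp add: det_mult[OF B(1) A(1)])
  finally show ?thesis using A(2) B(2) by simp
qed

lemma matrix_rep_det_nonzero:
  assumes "group G" "matrix_rep G n \<rho>" "g \<in> carrier G"
  shows "det (\<rho> g) \<noteq> 0"
proof -
  interpret group G by fact
  have "det (\<rho> g) * det (\<rho> (inv\<^bsub>G\<^esub> g)) = det (\<rho> g * \<rho> (inv\<^bsub>G\<^esub> g))"
    using assms(3) by (intro det_mult[symmetric, of _ n] matrix_rep_carrier[OF assms(2)]) auto
  then show ?thesis using matrix_rep_inv(1)[OF assms] by auto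
qed

text \<open>
  If \<open>P\<close> did not act commutatively, there would be a commutator \<open>w\<close> of elements of \<open>P\<close>, as deep in the lower central
  series as possible, that acts nontrivially; by its depth \<open>\<rho> w\<close> commutes with \<open>P\<close> and is a scalar \<open>c\<close>. The determinant
  gives \<open>c\<^sup>n = 1\<close>, while \<open>c\<close> also has \<open>p\<close>-power order, and \<open>p\<close> does not divide \<open>n\<close>.
\<close>

lemma sylow_commutators_in_kernel:
  fixes G (structure)
  assumes G: "group G" and fin: "finite (carrier G)" and nil: "nilpotent_group G"
    and irr: "irreducible_rep G n \<rho>" and p: "Factorial_Ring.prime p" "\<not> p dvd n"
    and P: "subgroup P G" "card P = p ^ multiplicity p (Coset.order G)"
    and x: "x \<in> P" and y: "y \<in> P"
  shows "\<rho> x * \<rho> y = \<rho> y * \<rho> x"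
proof -
  interpret group G by fact
  note \<rho> = irreducible_rep_matrix_rep[OF irr]
  note n = irreducible_rep_degree_pos[OF irr]
  have Pc: "u \<in> carrier G" if "u \<in> P" for u using P(1) that subgroup.mem_carrier by metis
  obtain N where N: "lower_central_series G N = {\<one>}" using nil by (auto simp: nilpotent_group_def)
  \<comment> \<open>Downward induction along the lower central series, starting from the trivial term.\<close>
  have "\<forall>x\<in>P \<inter> lower_central_series G (N - k). \<forall>y\<in>P. \<rho> x * \<rho> y = \<rho> y * \<rho> x" if "k \<le> N" for k
    using that
  proof (induction k)
    case 0
    have "\<rho> \<one> * \<rho> y = \<rho> y * \<rho> \<one>" if "y \<in> P" for y
      using matrix_rep_mult[OF \<rho> one_closed Pc[OF that]] matrix_rep_mult[OF \<rho> Pc[OF that] one_closed] Pc[OF that] by simp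
    then show ?case using N by simp
  next
    case (Suc k)
    show ?case
    proof (intro ballI)
      fix x y assume x: "x \<in> P \<inter> lower_central_series G (N - Suc k)" and y: "y \<in> P"
      define w where "w = x \<otimes> y \<otimes> inv x \<otimes> inv y"
      have xP: "x \<in> P" using x by simp
      note xc = Pc[OF xP] and yc = Pc[OF y]
      have wP: "w \<in> P" unfolding w_def using xP y P(1) by (intro subgroup.m_closed subgroup.m_inv_closed)
      have "Suc (N - Suc k) = N - k" using Suc.prems by simp
      then have "w \<in> lower_central_series G (N - k)"
        using lower_central_series_commutator[OF G _ yc, of x "N - Suc k"] x by (simp only: w_def) auto
      then have wcomm: "\<And>u. u \<in> P \<Longrightarrow> \<rho> w * \<rho> u = \<rho> u * \<rho> w" using Suc wP by auto
      obtain c where c: "\<rho> w = c \<cdot>\<^sub>m 1\<^sub>m n" "\<And>k::nat. w [^] k = \<one> \<Longrightarrow> c ^ k = 1"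
        using sylow_element_scalar[OF G fin nil irr p(1) P wP wcomm] by blast
      have YX: "\<rho> y * \<rho> x \<in> carrier_mat n n"
        using matrix_rep_carrier[OF \<rho>] xc yc by (meson mult_carrier_mat)
      have "\<rho> x * \<rho> y = \<rho> (w \<otimes> (y \<otimes> x))"
        using commutator_eq(2)[OF xc yc] xc yc by (simp add: w_def flip: matrix_rep_mult[OF \<rho>])
      also have "\<dots> = (c \<cdot>\<^sub>m 1\<^sub>m n) * (\<rho> y * \<rho> x)"
        using xc yc Pc[OF wP] by (simp add: matrix_rep_mult[OF \<rho>] c)
      also have "\<dots> = c \<cdot>\<^sub>m (\<rho> y * \<rho> x)"
        using mult_smult_assoc_mat[OF one_carrier_mat YX] left_mult_one_mat[OF YX] by simp
      finally have xy: "\<rho> x * \<rho> y = c \<cdot>\<^sub>m (\<rho> y * \<rho> x)" .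
      have "c ^ n = 1"
        by (rule scalar_commutator_root_of_unity[OF _ _ _ _ xy])
           (use xc yc matrix_rep_carrier[OF \<rho>] matrix_rep_det_nonzero[OF G \<rho>] in auto)
      moreover have "w [^] card P = \<one>" using ord_dvd_card_subgroup[OF P(1) wP] Pc[OF wP] pow_eq_id by simp
      then have "c ^ (p ^ multiplicity p (Coset.order G)) = 1" using c(2) P(2) by metis
      moreover have "coprime n (p ^ multiplicity p (Coset.order G))"
        using p by (meson coprime_commute coprime_power_right_iff prime_imp_coprime)
      ultimately have "c = 1" using power_coprime_eq_one by blast
      then show "\<rho> x * \<rho> y = \<rho> y * \<rho> x" using xy YX by (auto intro!: eq_matI)
    qed
  qed
  from this[of N] have "\<forall>x\<in>P \<inter> carrier G. \<forall>y\<in>P. \<rho> x * \<rho> y = \<rho> y * \<rho> x" by simp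
  then show ?thesis using x y Pc[OF x] by blast
qed

text \<open>
  If \<open>p\<close> does not divide the degree, a Sylow \<open>p\<close>-subgroup \<open>P\<close> acts by scalars. A faithful action by scalars would
  embed \<open>P\<close> in the multiplicative group of the complex numbers, whose finite subgroups are cyclic; so when \<open>P\<close> is
  not cyclic, the kernel meets it nontrivially.
\<close>

lemma prime_dvd_card_kernel_or_degree:
  fixes G (structure)
  assumes G: "group G" and fin: "finite (carrier G)" and nil: "nilpotent_group G"
    and irr: "irreducible_rep G n \<rho>" and p: "Factorial_Ring.prime p" "p dvd Coset.order G"
    and noncyc: "\<And>y. y \<in> carrier G \<Longrightarrow> group.ord G y \<noteq> p ^ multiplicity p (Coset.order G)"
  shows "p dvd card (rep_kernel G n \<rho>) \<or> p dvd n"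
proof (rule disjCI)
  assume pn: "\<not> p dvd n"
  interpret group G by fact
  note \<rho> = irreducible_rep_matrix_rep[OF irr]
  note n = irreducible_rep_degree_pos[OF irr]
  let ?a = "multiplicity p (Coset.order G)"
  have "Coset.order G \<noteq> 0" using fin order_gt_0_iff_finite by simp
  then have a: "?a > 0" using p by (simp add: prime_multiplicity_gt_zero_iff)
  then have lt: "p ^ (?a - 1) < p ^ ?a" using prime_gt_1_nat[OF p(1)] by simp
  obtain P where P: "subgroup P G" "card P = p ^ ?a" using sylow_exists[OF fin p(1)] by blast
  have Pc: "u \<in> carrier G" if "u \<in> P" for u using P(1) that subgroup.mem_carrier by metis
  have scal: "\<exists>c. \<rho> x = c \<cdot>\<^sub>m 1\<^sub>m n \<and> c ^ (p ^ (?a - 1)) = 1" if x: "x \<in> P" for x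
  proof -
    obtain c where c: "\<rho> x = c \<cdot>\<^sub>m 1\<^sub>m n" "\<And>k::nat. x [^] k = \<one> \<Longrightarrow> c ^ k = 1"
      using sylow_element_scalar[OF G fin nil irr p(1) P x
          sylow_commutators_in_kernel[OF G fin nil irr p(1) pn P x]] by blast
    have "ord x dvd p ^ ?a" using ord_dvd_card_subgroup[OF P(1) x] P(2) by simp
    then obtain b where b: "b \<le> ?a" "ord x = p ^ b" using divides_primepow_nat[OF p(1)] by blast
    moreover have "b \<noteq> ?a" using noncyc[OF Pc[OF x]] b(2) by auto
    ultimately have "ord x dvd p ^ (?a - 1)" by (simp add: le_imp_power_dvd)
    then show ?thesis using c pow_eq_id[OF Pc[OF x]] by blast
  qed
  \<comment> \<open>The scalar by which \<open>x\<close> acts. It is a root of unity of exponent \<open>p ^ (a - 1)\<close>, and there are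
    fewer of these than elements of \<open>P\<close>.\<close>
  define f where "f x = \<rho> x $$ (0, 0)" for x
  have f: "\<rho> x = f x \<cdot>\<^sub>m 1\<^sub>m n \<and> f x ^ (p ^ (?a - 1)) = 1" if "x \<in> P" for x
    using scal[OF that] n by (auto simp: f_def)
  have pos: "p ^ (?a - 1) \<ge> 1" using prime_gt_0_nat[OF p(1)] by (simp add: Suc_leI)
  have "\<not> inj_on f P"
  proof
    assume "inj_on f P"
    then have "card P = card (f ` P)" by (simp add: card_image)
    also have "\<dots> \<le> card {c::complex. c ^ (p ^ (?a - 1)) = 1}"
      using f pos by (intro card_mono finite_roots_unity) auto
    also have "\<dots> \<le> p ^ (?a - 1)" using pos by (intro card_roots_unity) auto
    finally show False using lt P(2) by simp
  qed
  then obtain x y where xy: "x \<in> P" "y \<in> P" "f x = f y" "x \<noteq> y" by (auto simp: inj_on_def)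
  note xc = Pc[OF xy(1)] and yc = Pc[OF xy(2)]
  define k where "k = x \<otimes> inv y"
  have kP: "k \<in> P" unfolding k_def using xy P(1) by (intro subgroup.m_closed subgroup.m_inv_closed)
  have "\<rho> x = \<rho> y" using f xy by metis
  then have "\<rho> k = 1\<^sub>m n"
    using xc yc by (simp add: k_def matrix_rep_mult[OF \<rho>] matrix_rep_inv[OF G \<rho>])
  then have kK: "k \<in> rep_kernel G n \<rho>" using Pc[OF kP] by (simp add: rep_kernel_def)
  have "ord k \<noteq> 1"
  proof
    assume "ord k = 1"
    then have "k = \<one>" using Pc[OF kP] ord_eq_1 by simp
    then show False using xy(4) xc yc inv_solve_right[of \<one> x y] by (simp add: k_def)
  qed
  moreover have "ord k dvd p ^ ?a" using ord_dvd_card_subgroup[OF P(1) kP] P(2) by simp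
  then obtain b where "ord k = p ^ b" using divides_primepow_nat[OF p(1)] by blast
  ultimately have "p dvd ord k" by (cases b) auto
  then show "p dvd card (rep_kernel G n \<rho>)"
    using ord_dvd_card_subgroup[OF rep_kernel_subgroup[OF G \<rho>] kK] dvd_trans by blast
qed

section \<open>Codegrees and central scalars\<close>

lemma rep_character_one:
  assumes "group G" "matrix_rep G n \<rho>"
  shows "rep_character G \<rho> \<one>\<^bsub>G\<^esub> = of_nat n"
proof -
  interpret group G by fact
  show ?thesis by (simp add: rep_character_def matrix_rep_one[OF assms] mat_trace_def)
qed

lemma rep_character_mult_kernel:
  assumes "group G" "matrix_rep G n \<rho>" "u \<in> carrier G" "k \<in> rep_kernel G n \<rho>"
  shows "rep_character G \<rho> (u \<otimes>\<^bsub>G\<^esub> k) = rep_character G \<rho> u"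
proof -
  interpret group G by fact
  show ?thesis
    using assms matrix_rep_mult[OF assms(2)] right_mult_one_mat[OF matrix_rep_carrier[OF assms(2)]]
    by (simp add: rep_character_def rep_kernel_def)
qed

text \<open>
  The kernel of the character contains the kernel \<open>K\<close> of the representation and is a union of cosets of \<open>K\<close>, since
  \<open>\<chi> (u k) = \<chi> u\<close> for \<open>k \<in> K\<close>. Hence each translate of it is determined by a coset of \<open>K\<close>.
\<close>

lemma card_rcosets_char_kernel_le:
  fixes G (structure)
  assumes G: "group G" and fin: "finite (carrier G)" and \<rho>: "matrix_rep G n \<rho>"
  shows "card (rcosets (char_kernel G (rep_character G \<rho>))) \<le> card (rcosets (rep_kernel G n \<rho>))"
proof -
  interpret group G by fact
  let ?C = "char_kernel G (rep_character G \<rho>)" and ?K = "rep_kernel G n \<rho>"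
  have C: "?C \<subseteq> carrier G" and K: "?K \<subseteq> carrier G" by (auto simp: char_kernel_def rep_kernel_def)
  note Ksub = rep_kernel_subgroup[OF G \<rho>]
  have closed: "u \<otimes> k \<in> ?C" if "u \<in> ?C" "k \<in> ?K" for u k
  proof -
    have "u \<in> carrier G" "k \<in> carrier G" using that C K by auto
    then show ?thesis
      using that rep_character_mult_kernel[OF G \<rho> \<open>u \<in> carrier G\<close> that(2)] by (simp add: char_kernel_def)
  qed
  have absorb: "?C #> k = ?C" if k: "k \<in> ?K" for k
  proof
    show "?C #> k \<subseteq> ?C" using closed k by (auto simp: r_coset_def)
    show "?C \<subseteq> ?C #> k"
    proof
      fix u assume u: "u \<in> ?C"
      have kc: "k \<in> carrier G" using k K by blast
      have uc: "u \<in> carrier G" using u C by blast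
      have "u \<otimes> inv k \<in> ?C" using closed[OF u subgroup.m_inv_closed[OF Ksub k]] .
      moreover have "u = (u \<otimes> inv k) \<otimes> k" using kc uc by (simp add: m_assoc)
      ultimately show "u \<in> ?C #> k" unfolding r_coset_def by blast
    qed
  qed
  have "rcosets ?C \<subseteq> (\<lambda>R. \<Union>x\<in>R. ?C #> x) ` (rcosets ?K)"
  proof
    fix S assume "S \<in> rcosets ?C"
    then obtain a where a: "a \<in> carrier G" "S = ?C #> a" by (auto simp: RCOSETS_def)
    have "?C #> x = ?C #> a" if x: "x \<in> ?K #> a" for x
    proof -
      obtain k where k: "k \<in> ?K" "x = k \<otimes> a" using x unfolding r_coset_def by blast
      have "k \<in> carrier G" using k(1) K by blast
      then have "?C #> x = (?C #> k) #> a" using coset_mult_assoc[OF C] a(1) k(2) by simp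
      then show ?thesis using absorb[OF k(1)] by simp
    qed
    moreover have "a \<in> ?K #> a" by (rule rcos_self[OF a(1) Ksub])
    ultimately have "S = (\<Union>x\<in>?K #> a. ?C #> x)" unfolding a(2) by blast
    moreover have "?K #> a \<in> rcosets ?K" using a(1) by (auto simp: RCOSETS_def)
    ultimately show "S \<in> (\<lambda>R. \<Union>x\<in>R. ?C #> x) ` (rcosets ?K)" by blast
  qed
  moreover have "finite (rcosets ?K)"
    by (rule finite_UnionD) (simp add: fin rcosets_part_G[OF Ksub])
  ultimately show ?thesis by (meson card_image_le card_mono finite_imageI order_trans)
qed

lemma codegree_le:
  fixes G (structure)
  assumes G: "group G" and fin: "finite (carrier G)" and irr: "irreducible_rep G n \<rho>"
  shows "codegree G (rep_character G \<rho>) \<le> real (Coset.order G) / real (card (rep_kernel G n \<rho>) * n)"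
proof -
  interpret group G by fact
  note \<rho> = irreducible_rep_matrix_rep[OF irr] and n = irreducible_rep_degree_pos[OF irr]
  let ?K = "rep_kernel G n \<rho>"
  note Ksub = rep_kernel_subgroup[OF G \<rho>]
  have "finite ?K" using fin by (simp add: rep_kernel_def)
  then have K0: "card ?K > 0" using subgroup.one_closed[OF Ksub] by (auto simp: card_gt_0_iff)
  have "real (card (rcosets ?K)) * real (card ?K) = real (Coset.order G)"
    using lagrange[OF Ksub] by (metis of_nat_mult)
  then have eq: "real (card (rcosets ?K)) = real (Coset.order G) / real (card ?K)"
    using K0 by (simp add: field_simps)
  have "codegree G (rep_character G \<rho>) =
      real (card (rcosets (char_kernel G (rep_character G \<rho>)))) / real n"
    by (simp add: codegree_def rep_character_one[OF G \<rho>])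
  also have "\<dots> \<le> real (card (rcosets ?K)) / real n"
    using card_rcosets_char_kernel_le[OF G fin \<rho>] by (simp add: divide_right_mono)
  also have "\<dots> = real (Coset.order G) / real (card ?K * n)" by (simp add: eq)
  finally show ?thesis .
qed

lemma codegree_nonneg:
  assumes "group G" "\<chi> \<in> Irr G"
  shows "codegree G \<chi> \<ge> 0"
proof -
  obtain n \<rho> where "\<chi> = rep_character G \<rho>" "irreducible_rep G n \<rho>" using assms(2) by (auto simp: Irr_def)
  then show ?thesis
    using rep_character_one[OF assms(1) irreducible_rep_matrix_rep] by (simp add: codegree_def)
qed

definition unity_root :: "nat \<Rightarrow> complex" where "unity_root n = cis (2 * pi / real n)"

lemma unity_root_power: "unity_root n ^ k = cis (2 * pi * real k / real n)"
  by (simp add: unity_root_def DeMoivre mult_ac)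

lemma unity_root_power_eq_one_iff:
  assumes "n > 0"
  shows "unity_root n ^ k = 1 \<longleftrightarrow> n dvd k"
proof -
  have inj: "inj_on (\<lambda>k. unity_root n ^ k) {..<n}"
    using bij_betw_imp_inj_on[OF bij_betw_roots_unity[OF assms]] by (simp add: unity_root_power)
  have one: "unity_root n ^ n = 1" using assms by (simp add: unity_root_power)
  have "unity_root n ^ k = unity_root n ^ (n * (k div n) + k mod n)" by simp
  also have "\<dots> = unity_root n ^ (k mod n)" by (simp only: power_add power_mult one power_one mult_1)
  finally have "unity_root n ^ k = 1 \<longleftrightarrow> unity_root n ^ (k mod n) = unity_root n ^ 0" by simp
  also have "\<dots> \<longleftrightarrow> k mod n = 0" using inj_on_eq_iff[OF inj, of "k mod n" 0] assms by simp
  finally show ?thesis by (simp add: dvd_eq_mod_eq_0)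
qed

lemma root_of_unity_eq_unity_root_power:
  assumes "n > 0" "c ^ n = (1::complex)"
  obtains j where "j \<in> {0<..n}" "c = unity_root n ^ j"
proof -
  have "c \<in> (\<lambda>k. unity_root n ^ k) ` {..<n}"
    using bij_betw_imp_surj_on[OF bij_betw_roots_unity[OF assms(1)]] assms(2) by (simp add: unity_root_power)
  then obtain k where k: "k < n" "c = unity_root n ^ k" by auto
  show ?thesis
  proof (cases "k = 0")
    case True
    \<comment> \<open>The exponent \<open>n\<close> stands for \<open>0\<close>, so that exponents range over \<open>{0<..n}\<close> as in the totient sums.\<close>
    then have "c = unity_root n ^ n" using k unity_root_power_eq_one_iff[OF assms(1), of n] by simp
    then show ?thesis using that[of n] assms(1) by simp
  next
    case False
    then show ?thesis using that[of k] k by simp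
  qed
qed

lemma prod_primes_dvd:
  fixes n :: nat
  assumes "finite S" "\<And>p. p \<in> S \<Longrightarrow> Factorial_Ring.prime p" "\<And>p. p \<in> S \<Longrightarrow> p dvd n"
  shows "\<Prod>S dvd n"
  using assms
proof (induction S rule: finite_induct)
  case (insert p S)
  have "coprime p (\<Prod>S)"
    by (rule prod_coprime_right) (use insert in \<open>auto intro: primes_coprime\<close>)
  then show ?case using insert by (simp add: divides_mult)
qed simp

text \<open>
  The central element \<open>z\<close> acts by a scalar \<open>c\<close> that is a root of unity of order \<open>m / gcd(j, m)\<close>, where \<open>m\<close> is the
  order of \<open>z\<close>. So the power of \<open>z\<close> with that exponent, an element of order \<open>gcd(j, m)\<close>, lies in the kernel.
\<close>

lemma central_scalar_character:
  fixes G (structure)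
  assumes G: "group G" and fin: "finite (carrier G)" and z: "z \<in> carrier G"
    and central: "\<And>g. g \<in> carrier G \<Longrightarrow> g \<otimes> z = z \<otimes> g"
    and irr: "irreducible_rep G n \<rho>"
  obtains j where "j \<in> {0<..group.ord G z}"
    "\<And>g. g \<in> carrier G \<Longrightarrow>
      rep_character G \<rho> (z \<otimes> g) = unity_root (group.ord G z) ^ j * rep_character G \<rho> g"
    "gcd j (group.ord G z) dvd card (rep_kernel G n \<rho>)"
proof -
  interpret group G by fact
  note \<rho> = irreducible_rep_matrix_rep[OF irr] and n = irreducible_rep_degree_pos[OF irr]
  have m: "ord z > 0" using ord_ge_1[OF fin z] by simp
  have "\<rho> z * \<rho> g = \<rho> g * \<rho> z" if "g \<in> carrier G" for g
    using matrix_rep_mult[OF \<rho>] central that z by metis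
  then obtain c where c: "\<rho> z = c \<cdot>\<^sub>m 1\<^sub>m n"
    using schur_scalar[OF irr matrix_rep_carrier[OF \<rho> z]] by blast
  have pow1: "c ^ k = 1 \<longleftrightarrow> z [^] k \<in> rep_kernel G n \<rho>" for k :: nat
    using rep_pow_scalar[OF G \<rho> z c, of k] z smult_one_mat_eq_one_iff[OF n] by (simp add: rep_kernel_def)
  have "z [^] ord z \<in> rep_kernel G n \<rho>"
    using z subgroup.one_closed[OF rep_kernel_subgroup[OF G \<rho>]] by simp
  then have "c ^ ord z = 1" using pow1 by blast
  then obtain j where j: "j \<in> {0<..ord z}" "c = unity_root (ord z) ^ j"
    using root_of_unity_eq_unity_root_power[OF m] by blast
  have trace: "rep_character G \<rho> (z \<otimes> g) = c * rep_character G \<rho> g" if g: "g \<in> carrier G" for g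
  proof -
    have R: "\<rho> g \<in> carrier_mat n n" by (rule matrix_rep_carrier[OF \<rho> g])
    have "\<rho> (z \<otimes> g) = c \<cdot>\<^sub>m \<rho> g"
      using matrix_rep_mult[OF \<rho> z g] mult_smult_assoc_mat[OF one_carrier_mat R] left_mult_one_mat[OF R]
      by (simp add: c)
    then show ?thesis using g z R by (simp add: rep_character_def mat_trace_def sum_distrib_left)
  qed
  let ?d = "gcd j (ord z)"
  have d: "?d dvd ord z" "?d > 0" using m by auto
  obtain a where a: "j = ?d * a" using gcd_dvd1 by (rule dvdE)
  obtain b where b: "ord z = ?d * b" using gcd_dvd2 by (rule dvdE)
  have "j * b = ord z * a" by (subst a, subst (2) b) simp
  then have "c ^ b = 1"
    unfolding j(2) power_mult[symmetric] by (simp add: unity_root_power_eq_one_iff[OF m])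
  then have mem: "z [^] b \<in> rep_kernel G n \<rho>" using pow1 by blast
  have "b \<noteq> 0" using b m by (intro notI) simp
  moreover have "b dvd ord z" by (subst b) simp
  ultimately have "ord (z [^] b) = ord z div b" using z by (intro ord_pow) auto
  also have "\<dots> = ?d" using nonzero_mult_div_cancel_right[OF \<open>b \<noteq> 0\<close>, of ?d] b by metis
  finally have "?d dvd card (rep_kernel G n \<rho>)"
    using ord_dvd_card_subgroup[OF rep_kernel_subgroup[OF G \<rho>] mem] by simp
  then show ?thesis using that j trace by metis
qed

section \<open>A divisor sum\<close>

text \<open>
  The value of the codegree sum at a cyclic group of order \<open>n\<close>, which is also the sum of the orders of its
  elements: there are \<open>totient d\<close> elements, and as many linear characters, of each order \<open>d\<close> dividing \<open>n\<close>.
\<close>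

definition cyclic_codegree_sum :: "nat \<Rightarrow> nat" where
  "cyclic_codegree_sum n = (\<Sum>d | d dvd n. d * totient d)"

text \<open>
  Here \<open>n div gcd j n\<close> is the order of the \<open>j\<close>-th power of a generator, and the terms are grouped by it.
\<close>

lemma cyclic_codegree_sum_gcd:
  assumes "n > 0"
  shows "(\<Sum>j\<in>{0<..n}. n div gcd j n) = cyclic_codegree_sum n"
proof -
  have fin: "finite {d. d dvd n}" using assms by simp
  have "(\<Sum>j\<in>{0<..n}. n div gcd j n) =
      (\<Sum>d | d dvd n. \<Sum>j\<in>{j \<in> {0<..n}. gcd j n = d}. n div gcd j n)"
    by (rule sum.group[symmetric]) (use fin in auto)
  also have "\<dots> = (\<Sum>d | d dvd n. \<Sum>j\<in>{j \<in> {0<..n}. gcd j n = d}. n div d)"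
    by (intro sum.cong) auto
  also have "\<dots> = (\<Sum>d | d dvd n. totient (n div d) * (n div d))"
    using card_gcd_eq_totient[OF assms] by (intro sum.cong refl) simp
  also have "\<dots> = (\<Sum>d | d dvd n. totient d * d)"
    by (rule sum.reindex_bij_witness[of _ "\<lambda>d. n div d" "\<lambda>d. n div d"])
       (use assms in \<open>auto simp: div_div_eq_right\<close>)
  finally show ?thesis by (simp add: cyclic_codegree_sum_def mult.commute)
qed

text \<open>
  Each factor \<open>p\<^sup>k\<close> of \<open>h\<close> is at most \<open>\<phi>(p\<^sup>k) p = p\<^sup>k (p - 1)\<close>.
\<close>

lemma le_totient_mult_radical: "h \<le> totient h * \<Prod>(prime_factors h)"
proof (cases "h = 0")
  case False
  have "h = (\<Prod>p\<in>prime_factors h. p ^ multiplicity p h)" using False by (intro prime_factorization_nat) simp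
  also have "\<dots> \<le> (\<Prod>p\<in>prime_factors h. (p ^ (multiplicity p h - 1) * (p - 1)) * p)"
  proof (rule prod_mono)
    fix p assume p: "p \<in> prime_factors h"
    then have pr: "Factorial_Ring.prime p" and "multiplicity p h > 0"
      using False by (auto simp: prime_factors_multiplicity)
    then obtain k where k: "multiplicity p h = Suc k" by (cases "multiplicity p h") auto
    have "1 \<le> p - 1" using prime_ge_2_nat[OF pr] by simp
    then show "0 \<le> p ^ multiplicity p h \<and>
        p ^ multiplicity p h \<le> (p ^ (multiplicity p h - 1) * (p - 1)) * p"
      by (simp add: k)
  qed
  also have "\<dots> = totient h * \<Prod>(prime_factors h)"
    using False by (simp add: totient_formula1 prod.distrib)
  finally show ?thesis .
qed simp

text \<open>
  The left-hand side collects the divisors of \<open>m h\<close> that are multiples of \<open>h\<close>; the divisor \<open>1\<close> is not among them.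
\<close>

lemma cyclic_codegree_sum_coprime_mult_less:
  assumes "coprime m h" "m > 0" "h > 1"
  shows "cyclic_codegree_sum m * (h * totient h) < cyclic_codegree_sum (m * h)"
proof -
  have fin: "finite {d. d dvd m * h}" using assms by simp
  have inj: "inj_on (\<lambda>d. d * h) {d. d dvd m}" using assms(3) by (auto simp: inj_on_def)
  have sub: "(\<lambda>d. d * h) ` {d. d dvd m} \<subseteq> {d. d dvd m * h} - {1}" using assms(3) by auto
  have "cyclic_codegree_sum m * (h * totient h) = (\<Sum>d | d dvd m. (d * h) * totient (d * h))"
    unfolding cyclic_codegree_sum_def sum_distrib_right
  proof (intro sum.cong refl)
    fix d assume "d \<in> {d. d dvd m}"
    then have "coprime d h" using assms(1) by (meson coprime_divisors dvd_refl mem_Collect_eq)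
    then show "d * totient d * (h * totient h) = (d * h) * totient (d * h)"
      by (simp add: totient_mult_coprime)
  qed
  also have "\<dots> = (\<Sum>d\<in>(\<lambda>d. d * h) ` {d. d dvd m}. d * totient d)"
    by (simp add: sum.reindex[OF inj])
  also have "\<dots> \<le> (\<Sum>d\<in>{d. d dvd m * h} - {1}. d * totient d)"
    using fin sub by (intro sum_mono2) auto
  also have "\<dots> < cyclic_codegree_sum (m * h)"
    unfolding cyclic_codegree_sum_def using sum.remove[OF fin, of 1 "\<lambda>d. d * totient d"] by simp
  finally show ?thesis .
qed

section \<open>An upper bound for the codegree sum\<close>

text \<open>
  Let \<open>z\<close> act on an irreducible representation of degree \<open>d\<close> by the \<open>j\<close>-th power of a primitive \<open>m\<close>-th root of unity.
  The kernel order times \<open>d\<close> is divisible by \<open>gcd(j, m)\<close> and, by hypothesis, by every prime factor of \<open>h\<close>, so the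
  codegree is at most \<open>(m / gcd(j, m)) (h / rad h)\<close>. At most \<open>h\<close> characters share the same \<open>j\<close>, and summing over
  \<open>j\<close> gives the bound. With \<open>z\<close> a generator of a cyclic group and \<open>h = 1\<close> it is the sharp bound for that group.
\<close>

lemma Irr_finite_codegree_sum_le:
  fixes G (structure)
  assumes G: "group G" and fin: "finite (carrier G)" and z: "z \<in> carrier G"
    and central: "\<And>g. g \<in> carrier G \<Longrightarrow> g \<otimes> z = z \<otimes> g"
    and n: "Coset.order G = group.ord G z * h" and cop: "coprime (group.ord G z) h"
    and primes: "\<And>d \<rho> p. irreducible_rep G d \<rho> \<Longrightarrow> p \<in> prime_factors h \<Longrightarrow>
      p dvd card (rep_kernel G d \<rho>) * d"
  shows "finite (Irr G)"
    and "codegree_sum G \<le>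
      real (cyclic_codegree_sum (group.ord G z)) * (real h * real h / real (\<Prod>(prime_factors h)))"
proof -
  interpret group G by fact
  let ?m = "ord z" and ?r = "\<Prod>(prime_factors h)"
  have m: "?m > 0" using ord_ge_1[OF fin z] by simp
  have "Coset.order G > 0" using fin order_gt_0_iff_finite by simp
  then have h: "h > 0" using n by (auto intro: gr0I)
  have r: "?r > 0" by (rule prod_pos) (auto dest: in_prime_factors_imp_prime prime_gt_0_nat)
  have cop_r: "coprime (gcd j ?m) ?r" for j
  proof (rule prod_coprime_right)
    fix p assume "p \<in> prime_factors h"
    then show "coprime (gcd j ?m) p" using cop by (meson coprime_divisors gcd_dvd2 in_prime_factors_imp_dvd)
  qed
  have "\<exists>j\<in>{0<..?m}. (\<forall>g\<in>carrier G. \<chi> (z \<otimes> g) = unity_root ?m ^ j * \<chi> g) \<and>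
      codegree G \<chi> \<le> real (?m div gcd j ?m) * (real h / real ?r)" if \<chi>: "\<chi> \<in> Irr G" for \<chi>
  proof -
    obtain d \<rho> where irr: "irreducible_rep G d \<rho>" and \<chi>\<rho>: "\<chi> = rep_character G \<rho>"
      using \<chi> by (auto simp: Irr_def)
    obtain j where j: "j \<in> {0<..?m}"
      "\<And>g. g \<in> carrier G \<Longrightarrow> rep_character G \<rho> (z \<otimes> g) = unity_root ?m ^ j * rep_character G \<rho> g"
      "gcd j ?m dvd card (rep_kernel G d \<rho>)"
      using central_scalar_character[OF G fin z central irr] by blast
    let ?k = "card (rep_kernel G d \<rho>) * d"
    have "?r dvd ?k" using primes[OF irr] by (intro prod_primes_dvd) auto
    moreover have "gcd j ?m dvd ?k" using j(3) by simp
    ultimately have dvd: "gcd j ?m * ?r dvd ?k" using cop_r divides_mult by blast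
    have Ksub: "subgroup (rep_kernel G d \<rho>) G"
      by (rule rep_kernel_subgroup[OF G irreducible_rep_matrix_rep[OF irr]])
    have "finite (rep_kernel G d \<rho>)" using fin by (simp add: rep_kernel_def)
    then have "card (rep_kernel G d \<rho>) > 0"
      using subgroup.one_closed[OF Ksub] by (auto simp: card_gt_0_iff)
    then have "?k > 0" using irreducible_rep_degree_pos[OF irr] by simp
    then have le: "gcd j ?m * ?r \<le> ?k" using dvd by (rule dvd_imp_le[rotated])
    have g0: "gcd j ?m > 0" using m by simp
    have pos: "0 < gcd j ?m * ?r" using g0 r by simp
    have "codegree G \<chi> \<le> real (Coset.order G) / real ?k"
      unfolding \<chi>\<rho> by (rule codegree_le[OF G fin irr])
    also have "\<dots> \<le> real (Coset.order G) / real (gcd j ?m * ?r)"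
      by (rule divide_left_mono) (use le pos \<open>?k > 0\<close> in \<open>simp_all only: of_nat_le_iff of_nat_0_le_iff zero_less_mult_iff of_nat_0_less_iff simp_thms\<close>)
    also have "\<dots> = (real ?m / real (gcd j ?m)) * (real h / real ?r)" by (simp add: n)
    also have "real ?m / real (gcd j ?m) = real (?m div gcd j ?m)" by (simp add: real_of_nat_div)
    finally show ?thesis using j by (auto simp: \<chi>\<rho>)
  qed
  then obtain J where J: "\<And>\<chi>. \<chi> \<in> Irr G \<Longrightarrow> J \<chi> \<in> {0<..?m}"
    "\<And>\<chi> g. \<chi> \<in> Irr G \<Longrightarrow> g \<in> carrier G \<Longrightarrow> \<chi> (z \<otimes> g) = unity_root ?m ^ J \<chi> * \<chi> g"
    "\<And>\<chi>. \<chi> \<in> Irr G \<Longrightarrow> codegree G \<chi> \<le> real (?m div gcd (J \<chi>) ?m) * (real h / real ?r)"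
    by metis
  define Irr_over where "Irr_over j = {\<chi> \<in> Irr G. J \<chi> = j}" for j
  have Irr_over: "finite (Irr_over j) \<and> card (Irr_over j) \<le> h" for j
  proof -
    have "finite (Irr_over j) \<and> card (Irr_over j) \<le> Coset.order G div ?m"
      by (rule card_Irr_over_scalar[OF G fin z, where \<zeta> = "unity_root ?m ^ j"]) (use J(2) in \<open>auto simp: Irr_over_def\<close>)
    then show ?thesis using n m by simp
  qed
  have "Irr G = (\<Union>j\<in>{0<..?m}. Irr_over j)" using J(1) by (auto simp: Irr_over_def)
  then show finI: "finite (Irr G)" using Irr_over by simp
  have "codegree_sum G = (\<Sum>j\<in>{0<..?m}. \<Sum>\<chi>\<in>Irr_over j. codegree G \<chi>)"
    unfolding codegree_sum_def Irr_over_def by (rule sum.group[symmetric, OF finI]) (use J(1) in auto)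
  also have "\<dots> \<le> (\<Sum>j\<in>{0<..?m}. \<Sum>\<chi>\<in>Irr_over j. real (?m div gcd j ?m) * (real h / real ?r))"
    using J(3) by (intro sum_mono) (auto simp: Irr_over_def)
  also have "\<dots> \<le> (\<Sum>j\<in>{0<..?m}. real h * (real (?m div gcd j ?m) * (real h / real ?r)))"
  proof (rule sum_mono)
    fix j
    have "real (card (Irr_over j)) * (real (?m div gcd j ?m) * (real h / real ?r))
        \<le> real h * (real (?m div gcd j ?m) * (real h / real ?r))"
      by (intro mult_right_mono mult_nonneg_nonneg divide_nonneg_nonneg of_nat_0_le_iff)
         (use Irr_over[of j] in simp)
    then show "(\<Sum>\<chi>\<in>Irr_over j. real (?m div gcd j ?m) * (real h / real ?r))
        \<le> real h * (real (?m div gcd j ?m) * (real h / real ?r))" by simp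
  qed
  also have "\<dots> = real (\<Sum>j\<in>{0<..?m}. ?m div gcd j ?m) * (real h * real h / real ?r)"
    by (simp add: sum_distrib_right sum_distrib_left mult_ac)
  also have "\<dots> = real (cyclic_codegree_sum ?m) * (real h * real h / real ?r)"
    by (simp only: cyclic_codegree_sum_gcd[OF m])
  finally show "codegree_sum G \<le> real (cyclic_codegree_sum ?m) * (real h * real h / real ?r)" .
qed

section \<open>Cyclic groups\<close>

lemma irreducible_rep_degree_one:
  assumes "matrix_rep G 1 \<rho>"
  shows "irreducible_rep G 1 \<rho>"
  unfolding irreducible_rep_def
proof (intro conjI allI impI assms)
  fix W assume "VectorSpace.subspace class_ring W (module_vec TYPE(complex) 1)"
  then have sub: "submodule class_ring W (module_vec TYPE(complex) 1)"
    by (simp add: VectorSpace.subspace_def)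
  have W: "W \<subseteq> carrier_vec 1" and zero: "0\<^sub>v 1 \<in> W"
    and smult: "\<And>c v. v \<in> W \<Longrightarrow> c \<cdot>\<^sub>v v \<in> W"
    using submodule.subset[OF sub] submodule.zero_closed[OF sub] submodule.smult_closed[OF sub]
    by (simp_all add: module_vec_simps)
  show "W = {0\<^sub>v 1} \<or> W = carrier_vec 1"
  proof (cases "W = {0\<^sub>v 1}")
    case False
    then obtain v where v: "v \<in> W" "v \<noteq> 0\<^sub>v 1" using zero by blast
    have vc: "v \<in> carrier_vec 1" using v W by blast
    have v0: "v $ 0 \<noteq> 0"
    proof
      assume "v $ 0 = 0"
      then have "v = 0\<^sub>v 1" using vc by (intro eq_vecI) auto
      then show False using v(2) by contradiction
    qed
    have "u \<in> W" if u: "u \<in> carrier_vec 1" for u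
    proof -
      have "u = (u $ 0 / v $ 0) \<cdot>\<^sub>v v" using u vc v0 by (intro eq_vecI) auto
      then show ?thesis using smult[OF v(1)] by metis
    qed
    then show ?thesis using W by blast
  qed simp
qed simp

lemma (in group) generate_eq_carrier:
  assumes fin: "finite (carrier G)" and x: "x \<in> carrier G" and ord: "ord x = Coset.order G"
  shows "generate G {x} = carrier G"
  using generate_pow_card[OF x] x ord fin generate_incl[of "{x}"]
  by (intro card_subset_eq) (auto simp: Coset.order_def)

lemma (in group) cyclic_group_generator:
  assumes fin: "finite (carrier G)"
  shows "cyclic_group G \<longleftrightarrow> (\<exists>x\<in>carrier G. ord x = Coset.order G)"
proof
  assume "cyclic_group G"
  then obtain x where x: "x \<in> carrier G" "carrier G = range (\<lambda>n::int. x [^] n)"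
    using cyclic_group by blast
  then have "generate G {x} = carrier G" using generate_pow[OF x(1)] by auto
  then show "\<exists>x\<in>carrier G. ord x = Coset.order G"
    using generate_pow_card[OF x(1)] x(1) by (auto simp: Coset.order_def)
next
  assume "\<exists>x\<in>carrier G. ord x = Coset.order G"
  then obtain x where x: "x \<in> carrier G" "ord x = Coset.order G" by blast
  have "generate G {x} = carrier G" by (rule generate_eq_carrier[OF fin x])
  then have "carrier G = {x [^] k | k. k \<in> (UNIV::int set)}" using generate_pow[OF x(1)] by metis
  also have "\<dots> = range (\<lambda>n::int. x [^] n)" by blast
  finally have "carrier G = range (\<lambda>n::int. x [^] n)" .
  then show "cyclic_group G" using cyclic_group x(1) by blast
qed

text \<open>
  The power \<open>c ^ k\<close> depends only on \<open>x [^] k\<close>, because exponents of \<open>x\<close> matter modulo the group order and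
  \<open>c\<close> is a root of unity of that exponent.
\<close>

lemma cyclic_character:
  fixes G (structure)
  assumes G: "group G" and fin: "finite (carrier G)" and x: "x \<in> carrier G"
    and n: "group.ord G x = Coset.order G" and c: "c ^ Coset.order G = (1::complex)"
  obtains \<chi> where "\<chi> \<in> Irr G" "\<And>k::nat. \<chi> (x [^] k) = c ^ k"
proof -
  interpret group G by fact
  have full: "carrier G = {x [^] k | k. k \<in> (UNIV::nat set)}"
    using generate_eq_carrier[OF fin x n] generate_pow_on_finite_carrier[OF fin x] by simp
  \<comment> \<open>A discrete logarithm to the base \<open>x\<close>; the choice of the exponent does not affect powers of \<open>c\<close>.\<close>
  define lg where "lg g = (SOME k::nat. g = x [^] k)" for g
  have lg: "g = x [^] lg g" if "g \<in> carrier G" for g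
    using that full unfolding lg_def by (auto intro: someI)
  have welldef: "c ^ k = c ^ l" if "x [^] k = x [^] l" for k l :: nat
  proof -
    have eq: "c ^ (a + t) = c ^ a" if "x [^] (a + t) = x [^] a" for a t :: nat
    proof -
      have "x [^] a \<otimes> x [^] t = x [^] a \<otimes> \<one>" using that x by (simp add: nat_pow_mult)
      then have "x [^] t = \<one>" using x by simp
      then have "Coset.order G dvd t" using pow_eq_id[OF x] n by simp
      then obtain s where s: "t = Coset.order G * s" by (rule dvdE)
      show ?thesis by (simp only: power_add s power_mult c power_one mult_1_right)
    qed
    show ?thesis
    proof (cases "k \<le> l")
      case True
      then show ?thesis using eq[of k "l - k"] that by simp
    next
      case False
      then show ?thesis using eq[of l "k - l"] that by simp
    qed
  qed
  define \<rho> where "\<rho> g = mat 1 1 (\<lambda>_. c ^ lg g)" for g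
  have rep: "matrix_rep G 1 \<rho>"
  proof (rule matrix_repI[OF G])
    show "\<rho> g \<in> carrier_mat 1 1" for g by (simp add: \<rho>_def)
    fix g h assume g: "g \<in> carrier G" and h: "h \<in> carrier G"
    have "x [^] lg (g \<otimes> h) = x [^] (lg g + lg h)"
      using lg[OF g] lg[OF h] lg[of "g \<otimes> h"] g h x by (metis m_closed nat_pow_mult)
    then have "c ^ lg (g \<otimes> h) = c ^ lg g * c ^ lg h" using welldef by (metis power_add)
    then show "\<rho> (g \<otimes> h) = \<rho> g * \<rho> h" by (intro eq_matI) (auto simp: \<rho>_def scalar_prod_def)
  next
    have "x [^] lg \<one> = x [^] (0::nat)" using lg[of \<one>] by simp
    then have "c ^ lg \<one> = c ^ 0" by (rule welldef)
    then show "\<rho> \<one> = 1\<^sub>m 1" by (intro eq_matI) (auto simp: \<rho>_def)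
  qed
  have "rep_character G \<rho> \<in> Irr G" using irreducible_rep_degree_one[OF rep] by (auto simp: Irr_def)
  moreover have "rep_character G \<rho> (x [^] k) = c ^ k" for k :: nat
    using welldef[of "lg (x [^] k)" k] lg[of "x [^] k"] x by (simp add: rep_character_def \<rho>_def mat_trace_def)
  ultimately show ?thesis using that by blast
qed

text \<open>
  The kernel of the \<open>j\<close>-th linear character consists of the powers of \<open>x\<close> whose exponent is a multiple of \<open>n / gcd(j, n)\<close>,
  so it has at most \<open>gcd(j, n)\<close> elements.
\<close>

lemma cyclic_character_codegree_ge:
  fixes G (structure)
  assumes G: "group G" and fin: "finite (carrier G)" and x: "x \<in> carrier G"
    and n: "group.ord G x = Coset.order G"
    and \<chi>: "\<And>k::nat. \<chi> (x [^] k) = unity_root (Coset.order G) ^ (j * k)"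
  shows "real (Coset.order G div gcd j (Coset.order G)) \<le> codegree G \<chi>"
proof -
  interpret group G by fact
  let ?n = "Coset.order G"
  have n0: "?n > 0" using fin order_gt_0_iff_finite by simp
  have elems: "carrier G = (\<lambda>k. x [^] k) ` {..<?n}"
  proof -
    have "generate G {x} = carrier G" by (rule generate_eq_carrier[OF fin x n])
    moreover have "{0..ord x - 1} = {..<?n}" using n n0 by auto
    ultimately show ?thesis
      using generate_pow_on_finite_carrier[OF fin x] ord_elems[OF fin x] by auto
  qed
  have one: "\<chi> \<one> = 1" using \<chi>[of 0] by simp
  let ?K = "char_kernel G \<chi>"
  have mem: "x [^] k \<in> ?K \<longleftrightarrow> ?n dvd j * k" for k :: nat
    using x by (simp add: char_kernel_def one \<chi> unity_root_power_eq_one_iff[OF n0])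
  define d where "d = gcd j ?n"
  have "d dvd j" "d dvd ?n" by (simp_all add: d_def)
  then obtain a b where a: "j = d * a" and b: "?n = d * b" by (metis dvdE)
  have d0: "d > 0" using n0 by (simp add: d_def)
  have b0: "b > 0" using b n0 by (cases b) auto
  have "coprime a b"
  proof (rule gcd_coprime)
    show "gcd j ?n \<noteq> 0" using d0 by (simp add: d_def)
    show "j = a * gcd j ?n" "?n = b * gcd j ?n" unfolding d_def[symmetric] using a b by (simp_all only: mult.commute)
  qed
  have "?K \<subseteq> (\<lambda>i. x [^] (b * i)) ` {..<d}"
  proof
    fix g assume g: "g \<in> ?K"
    then have "g \<in> carrier G" by (simp add: char_kernel_def)
    then obtain k where k: "k < ?n" "g = x [^] k" using elems by auto
    then have "?n dvd j * k" using g mem by simp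
    then have "d * b dvd d * (a * k)" using a b by (metis mult.assoc)
    then have "b dvd a * k" using d0 by simp
    then have "b dvd k" using \<open>coprime a b\<close> by (metis coprime_commute coprime_dvd_mult_right_iff)
    then obtain i where i: "k = b * i" by (rule dvdE)
    have "b * i < b * d" using k(1) b i by (metis mult.commute)
    then have "i < d" using b0 by simp
    then show "g \<in> (\<lambda>i. x [^] (b * i)) ` {..<d}" using k(2) i by blast
  qed
  then have "card ?K \<le> card ((\<lambda>i. x [^] (b * i)) ` {..<d})" by (intro card_mono) auto
  also have "\<dots> \<le> d" using card_image_le[of "{..<d}" "\<lambda>i. x [^] (b * i)"] by simp
  finally have cardK: "card ?K \<le> d" .
  have K: "subgroup ?K G"
  proof (rule subgroupI)
    show "?K \<subseteq> carrier G" by (auto simp: char_kernel_def)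
    show "?K \<noteq> {}" by (auto simp: char_kernel_def)
    have rep: "\<exists>k::nat. g = x [^] k \<and> ?n dvd j * k" if g: "g \<in> ?K" for g
    proof -
      have "g \<in> carrier G" using g by (simp add: char_kernel_def)
      then obtain k :: nat where "g = x [^] k" using elems by auto
      then show ?thesis using g mem by blast
    qed
    fix g assume g: "g \<in> ?K"
    then obtain k where k: "g = x [^] k" "?n dvd j * k" using rep by blast
    have "g [^] ?n = \<one>" using g pow_order_eq_1 by (simp add: char_kernel_def)
    moreover have gc: "g \<in> carrier G" using g by (simp add: char_kernel_def)
    ultimately have "inv g = g [^] (?n - 1)"
      using n0 by (intro inv_equality) (simp_all flip: nat_pow_Suc)
    also have "\<dots> = x [^] (k * (?n - 1))" using x by (simp add: k(1) nat_pow_pow)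
    finally show "inv g \<in> ?K" using mem k(2) by (simp add: mult.assoc[symmetric])
    fix h assume "h \<in> ?K"
    then obtain l where l: "h = x [^] l" "?n dvd j * l" using rep by blast
    have "g \<otimes> h = x [^] (k + l)" using x by (simp add: k(1) l(1) nat_pow_mult)
    then show "g \<otimes> h \<in> ?K" using mem k(2) l(2) by (simp add: distrib_left)
  qed
  have "card (rcosets ?K) * card ?K = ?n" by (rule lagrange[OF K])
  then have "d * b \<le> card (rcosets ?K) * d" using cardK b by (metis mult_le_mono2)
  then have "b \<le> card (rcosets ?K)" using d0 by (simp add: mult.commute)
  moreover have "?n div d = b" using d0 by (simp add: b)
  ultimately show ?thesis by (simp add: codegree_def one d_def)
qed

text \<open>
  The upper bound is the general one for \<open>h = 1\<close>; the \<open>n\<close> linear characters attain it.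
\<close>

lemma cyclic_group_codegree_sum:
  assumes G: "group G" and fin: "finite (carrier G)" and cyc: "cyclic_group G"
  shows "codegree_sum G = real (cyclic_codegree_sum (Coset.order G))"
proof -
  interpret group G by fact
  let ?n = "Coset.order G"
  have n0: "?n > 0" using fin order_gt_0_iff_finite by simp
  obtain x where x: "x \<in> carrier G" "ord x = ?n" using cyc cyclic_group_generator[OF fin] by blast
  interpret comm_group G by (rule cyclic_imp_abelian_group[OF cyc])
  have central: "\<And>g. g \<in> carrier G \<Longrightarrow> g \<otimes>\<^bsub>G\<^esub> x = x \<otimes>\<^bsub>G\<^esub> g" using x(1) m_comm by blast
  have finI: "finite (Irr G)"
    and le: "codegree_sum G \<le> real (cyclic_codegree_sum ?n)"
    using Irr_finite_codegree_sum_le[OF G fin x(1) central, where h = 1] x(2) by auto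
  have "\<exists>\<chi>. \<chi> \<in> Irr G \<and> (\<forall>k::nat. \<chi> (x [^]\<^bsub>G\<^esub> k) = unity_root ?n ^ (j * k))" for j
  proof -
    have "(unity_root ?n ^ j) ^ ?n = 1"
      using unity_root_power_eq_one_iff[OF n0, of "j * ?n"] by (simp add: power_mult)
    then show ?thesis using cyclic_character[OF G fin x] by (metis power_mult)
  qed
  then obtain \<chi> where \<chi>: "\<And>j. \<chi> j \<in> Irr G" "\<And>j k. \<chi> j (x [^]\<^bsub>G\<^esub> (k::nat)) = unity_root ?n ^ (j * k)"
    by metis
  have inj: "inj_on \<chi> {0<..?n}"
  proof (rule inj_onI)
    fix i j assume ij: "i \<in> {0<..?n}" "j \<in> {0<..?n}" "\<chi> i = \<chi> j"
    have aux: "i = j" if "i \<le> j" "i \<in> {0<..?n}" "j \<in> {0<..?n}" "\<chi> i = \<chi> j" for i j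
    proof -
      have "unity_root ?n ^ i = unity_root ?n ^ j" using \<chi>(2)[of i 1] \<chi>(2)[of j 1] that(4) by simp
      also have "\<dots> = unity_root ?n ^ i * unity_root ?n ^ (j - i)"
        using that(1) by (metis le_add_diff_inverse power_add)
      finally have "unity_root ?n ^ (j - i) = 1" by (simp add: unity_root_def)
      then have "?n dvd j - i" using unity_root_power_eq_one_iff[OF n0] by simp
      moreover have "j - i < ?n" using that(2,3) by auto
      ultimately have "j - i = 0" by (metis dvd_imp_le gr0I not_le)
      then show ?thesis using that(1) by simp
    qed
    show "i = j"
    proof (cases "i \<le> j")
      case True
      then show ?thesis using aux ij by blast
    next
      case False
      then have "j = i" by (intro aux[OF _ ij(2,1) ij(3)[symmetric]]) simp
      then show ?thesis by simp
    qed
  qed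
  have "real (cyclic_codegree_sum ?n) = (\<Sum>j\<in>{0<..?n}. real (?n div gcd j ?n))"
    unfolding cyclic_codegree_sum_gcd[OF n0, symmetric] by (rule of_nat_sum)
  also have "\<dots> \<le> (\<Sum>j\<in>{0<..?n}. codegree G (\<chi> j))"
    by (intro sum_mono cyclic_character_codegree_ge[OF G fin x] \<chi>(2))
  also have "\<dots> = (\<Sum>\<psi>\<in>\<chi> ` {0<..?n}. codegree G \<psi>)" by (simp add: sum.reindex[OF inj])
  also have "\<dots> \<le> codegree_sum G"
    unfolding codegree_sum_def using \<chi>(1) codegree_nonneg[OF G] by (intro sum_mono2 finI) auto
  finally show ?thesis using le by simp
qed

section \<open>Nilpotent groups\<close>

text \<open>
  With \<open>z\<close> of maximal order \<open>m\<close> coprime to \<open>h = n / m\<close> and \<open>F\<close> standing for \<^const>\<open>cyclic_codegree_sum\<close>, the general bound is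
  \<open>F(m) h\<^sup>2 / rad h \<le> F(m) h \<phi>(h) < F(m h)\<close>, where \<open>h > 1\<close> because \<open>z\<close> does not generate \<open>G\<close>.
\<close>

lemma noncyclic_nilpotent_codegree_sum_less:
  assumes G: "group G" and fin: "finite (carrier G)" and nil: "nilpotent_group G"
    and noncyc: "\<not> cyclic_group G"
  shows "codegree_sum G < real (cyclic_codegree_sum (Coset.order G))"
proof -
  interpret group G by fact
  let ?n = "Coset.order G"
  have n0: "?n > 0" using fin order_gt_0_iff_finite by simp
  obtain z where z: "z \<in> carrier G" and cop: "coprime (ord z) (?n div ord z)"
    and max: "\<And>p y. Factorial_Ring.prime p \<Longrightarrow> p dvd ?n div ord z \<Longrightarrow> y \<in> carrier G \<Longrightarrow>
      ord y \<noteq> p ^ multiplicity p ?n"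
    using maximal_unitary_element[OF G fin nil] by blast
  define h where "h = ?n div ord z"
  have n: "?n = ord z * h" using ord_dvd_group_order[OF z] by (simp add: h_def)
  have m0: "ord z > 0" and h0: "h > 0" using n n0 by (auto intro!: gr0I)
  have "h \<noteq> 1" using n noncyc cyclic_group_generator[OF fin] z by auto
  then have h1: "h > 1" using h0 by simp
  have central: "g \<otimes>\<^bsub>G\<^esub> z = z \<otimes>\<^bsub>G\<^esub> g" if "g \<in> carrier G" for g
    by (rule unitary_element_central[OF G fin nil z cop that])
  have "p dvd card (rep_kernel G d \<rho>) * d"
    if irr: "irreducible_rep G d \<rho>" and p: "p \<in> prime_factors h" for d \<rho> p
  proof -
    have pr: "Factorial_Ring.prime p" and ph: "p dvd h" using p by auto
    have "p dvd ?n" using ph n by simp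
    then show ?thesis
      using prime_dvd_card_kernel_or_degree[OF G fin nil irr pr] max[OF pr] ph
      by (auto simp: h_def)
  qed
  then have "codegree_sum G \<le>
      real (cyclic_codegree_sum (ord z)) * (real h * real h / real (\<Prod>(prime_factors h)))"
    using Irr_finite_codegree_sum_le(2)[OF G fin z central n] cop by (simp add: h_def)
  also have "\<dots> \<le> real (cyclic_codegree_sum (ord z)) * (real h * real (totient h))"
  proof -
    have r: "\<Prod>(prime_factors h) > 0"
      by (rule prod_pos) (auto dest: in_prime_factors_imp_prime prime_gt_0_nat)
    have "real h \<le> real (totient h) * real (\<Prod>(prime_factors h))"
      using le_totient_mult_radical[of h] by (metis of_nat_le_iff of_nat_mult)
    then have "real h / real (\<Prod>(prime_factors h)) \<le> real (totient h)"
      using r by (simp only: pos_divide_le_eq of_nat_0_less_iff)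
    then have "real h * (real h / real (\<Prod>(prime_factors h))) \<le> real h * real (totient h)"
      by (rule mult_left_mono) simp
    then show ?thesis by (intro mult_left_mono) simp_all
  qed
  also have "\<dots> = real (cyclic_codegree_sum (ord z) * (h * totient h))" by simp
  also have "\<dots> < real (cyclic_codegree_sum (ord z * h))"
    using cyclic_codegree_sum_coprime_mult_less[of "ord z" h] cop m0 h1 by (simp only: h_def of_nat_less_iff)
  finally show ?thesis using n by simp
qed

lemma integer_mod_group_cyclic:
  assumes "n > 0"
  shows "finite (carrier (integer_mod_group n))" "Coset.order (integer_mod_group n) = n"
    "cyclic_group (integer_mod_group n)"
proof -
  interpret Z: group "integer_mod_group n" by simp
  show "finite (carrier (integer_mod_group n))" "Coset.order (integer_mod_group n) = n"
    using assms by (auto simp: carrier_integer_mod_group Coset.order_def)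
  show "cyclic_group (integer_mod_group n)"
    unfolding Z.cyclic_group
  proof
    show c: "1 mod int n \<in> carrier (integer_mod_group n)" using assms by (simp add: carrier_integer_mod_group)
    show "carrier (integer_mod_group n) = range (\<lambda>k::int. (1 mod int n) [^]\<^bsub>integer_mod_group n\<^esub> k)"
    proof
      show "carrier (integer_mod_group n) \<subseteq> range (\<lambda>k::int. (1 mod int n) [^]\<^bsub>integer_mod_group n\<^esub> k)"
      proof
        fix k assume "k \<in> carrier (integer_mod_group n)"
        then have "k = (1 mod int n) [^]\<^bsub>integer_mod_group n\<^esub> k"
          using assms by (simp add: carrier_integer_mod_group int_pow_integer_mod_group mod_mult_right_eq)
        then show "k \<in> range (\<lambda>k::int. (1 mod int n) [^]\<^bsub>integer_mod_group n\<^esub> k)" by blast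
      qed
    qed (use c Z.int_pow_closed in blast)
  qed
qed

theorem theorem1p1:
  fixes G :: "('a, 'b) monoid_scheme" and n :: nat
  assumes "group G" and "finite (carrier G)" and "nilpotent_group G" and "Coset.order G = n"
  shows "codegree_sum G \<le> codegree_sum (integer_mod_group n) \<and>
    (codegree_sum G = codegree_sum (integer_mod_group n) \<longleftrightarrow> cyclic_group G)"
proof -
  interpret group G by fact
  have "n > 0" using assms(2,4) order_gt_0_iff_finite by simp
  note Z = integer_mod_group_cyclic[OF this]
  have C: "codegree_sum (integer_mod_group n) = real (cyclic_codegree_sum n)"
    using cyclic_group_codegree_sum[OF group_integer_mod_group Z(1,3)] Z(2) by simp
  show ?thesis
  proof (cases "cyclic_group G")
    case True
    then show ?thesis using cyclic_group_codegree_sum[OF assms(1,2)] C assms(4) by simp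
  next
    case False
    then show ?thesis
      using noncyclic_nilpotent_codegree_sum_less[OF assms(1-3)] C assms(4) by simp
  qed
qed

end
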